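(* Let $(\rho(\theta))_{\theta\in\mathbb{R}^L}$ be a second-order differentiable family of positive definite states on a finite-dimensional Hilbert space. For all $\alpha\in(0,1)\cup(1,\infty)$, the elements of the Petz--Rényi information matrix are $$[\overline I_\alpha(\theta)]_{i,j}=\sum_{k,\ell}\overline\zeta_\alpha(\lambda_k,\lambda_\ell)\,\mathrm{Tr}\left[\Pi_k(\partial_i\rho(\theta))\Pi_\ell(\partial_j\rho(\theta))\right],$$ where $\partial_i=\frac{\partial}{\partial\theta_i}$, the spectral decomposition of $\rho(\theta)$ is $\rho(\theta)=\sum_k\lambda_k\Pi_k$, and for all $x,y>0$, $$\overline\zeta_\alpha(x,y):=\begin{cases}\frac{1}{\alpha(1-\alpha)}\frac{(x^\alpha-y^\alpha)(x^{1-\alpha}-y^{1-\alpha})}{(x-y)^2}&:x\neq y\\ \frac1x&:x=y.\end{cases}$$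
   Context: A state is a positive semi-definite operator of unit trace. For positive definite states $\rho,\sigma$ and $\alpha\in(0,1)\cup(1,\infty)$, the Petz--Rényi relative entropy is $\overline D_\alpha(\rho\|\sigma):=\frac{1}{\alpha-1}\ln\mathrm{Tr}[\rho^\alpha\sigma^{1-\alpha}]$. The Petz--Rényi information matrix has entries $[\overline I_\alpha(\theta)]_{i,j}:=\frac1\alpha\left.\frac{\partial^2}{\partial\varepsilon_i\partial\varepsilon_j}\overline D_\alpha(\rho(\theta)\|\rho(\theta+\varepsilon))\right|_{\varepsilon=0}$. *)

theory Defs
  imports "HOL-Analysis.Analysis"
begin

text \<open>
  A finite-dimensional Hilbert space is \<open>complex^'n\<close> and its operators are the matrices
  \<open>complex^'n^'n\<close>. The library's inner product \<open>v \<bullet> w\<close> on \<open>complex^'n\<close> is the real part of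
  the Hermitian one, so for Hermitian \<open>A\<close> the number \<open>v \<bullet> (A *v v)\<close> is the quadratic form
  of \<open>A\<close>.
\<close>

definition hermitian :: "complex^'n^'n \<Rightarrow> bool" where
  "hermitian A \<longleftrightarrow> (\<forall>i j. A $ i $ j = cnj (A $ j $ i))"

definition pos_semidefinite :: "complex^'n^'n \<Rightarrow> bool" where
  "pos_semidefinite A \<longleftrightarrow> hermitian A \<and> (\<forall>v. 0 \<le> v \<bullet> (A *v v))"

definition pos_definite :: "complex^'n^'n \<Rightarrow> bool" where
  "pos_definite A \<longleftrightarrow> hermitian A \<and> (\<forall>v. v \<noteq> 0 \<longrightarrow> 0 < v \<bullet> (A *v v))"

definition is_state :: "complex^'n^'n \<Rightarrow> bool" where
  "is_state A \<longleftrightarrow> pos_semidefinite A \<and> trace A = 1"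

text \<open>
  Spectral decomposition of a Hermitian matrix: \<open>A\<close> is the sum of \<open>x *\<^sub>R eigenprojection A x\<close>
  over its distinct eigenvalues \<open>x\<close>, which are real.
\<close>

definition eigenspace :: "complex^'n^'n \<Rightarrow> real \<Rightarrow> (complex^'n) set" where
  "eigenspace A x = {v. A *v v = complex_of_real x *s v}"

definition eigenvalues :: "complex^'n^'n \<Rightarrow> real set" where
  "eigenvalues A = {x. \<exists>v. v \<noteq> 0 \<and> v \<in> eigenspace A x}"

definition orth_projection_onto :: "(complex^'n) set \<Rightarrow> complex^'n^'n \<Rightarrow> bool" where
  "orth_projection_onto S P \<longleftrightarrow> hermitian P \<and> P ** P = P \<and> range ((*v) P) = S"

definition eigenprojection :: "complex^'n^'n \<Rightarrow> real \<Rightarrow> complex^'n^'n" where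
  "eigenprojection A x = (THE P. orth_projection_onto (eigenspace A x) P)"

definition matrix_powr :: "complex^'n^'n \<Rightarrow> real \<Rightarrow> complex^'n^'n" where
  "matrix_powr A a = (\<Sum>x\<in>eigenvalues A. (x powr a) *\<^sub>R eigenprojection A x)"

text \<open>
  For positive definite arguments the trace below is a positive real number;
  \<open>Re\<close> only changes its type.
\<close>

definition petz_renyi_entropy :: "real \<Rightarrow> complex^'n^'n \<Rightarrow> complex^'n^'n \<Rightarrow> real" where
  "petz_renyi_entropy \<alpha> \<rho> \<sigma> =
     1 / (\<alpha> - 1) * ln (Re (trace (matrix_powr \<rho> \<alpha> ** matrix_powr \<sigma> (1 - \<alpha>))))"

definition partial_deriv :: "'l \<Rightarrow> (real^'l \<Rightarrow> 'b::real_normed_vector) \<Rightarrow> real^'l \<Rightarrow> 'b" where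
  "partial_deriv i f x = vector_derivative (\<lambda>t. f (x + t *\<^sub>R axis i 1)) (at 0)"

definition twice_differentiable ::
    "('a::real_normed_vector \<Rightarrow> 'b::real_normed_vector) \<Rightarrow> bool" where
  "twice_differentiable f \<longleftrightarrow>
     (\<exists>f' :: 'a \<Rightarrow> 'a \<Rightarrow>\<^sub>L 'b. \<forall>x.
        (f has_derivative blinfun_apply (f' x)) (at x) \<and> f' differentiable (at x))"

definition petz_renyi_information ::
    "real \<Rightarrow> (real^'l \<Rightarrow> complex^'n^'n) \<Rightarrow> real^'l \<Rightarrow> real^'l^'l" where
  "petz_renyi_information \<alpha> \<rho> \<theta> =
     (\<chi> i j. 1 / \<alpha> *
        partial_deriv i (partial_deriv j
          (\<lambda>\<epsilon>. petz_renyi_entropy \<alpha> (\<rho> \<theta>) (\<rho> (\<theta> + \<epsilon>)))) 0)"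

definition petz_zeta :: "real \<Rightarrow> real \<Rightarrow> real \<Rightarrow> real" where
  "petz_zeta \<alpha> x y =
     (if x \<noteq> y then
        1 / (\<alpha> * (1 - \<alpha>)) *
        ((x powr \<alpha> - y powr \<alpha>) * (x powr (1 - \<alpha>) - y powr (1 - \<alpha>)) / (x - y)\<^sup>2)
      else 1 / x)"

end

theory Submission
  imports Defs
begin

text \<open>
  For Hermitian \<open>A\<close>, \<open>B\<close> with eigenprojections \<open>P\<^sub>x\<close>, \<open>Q\<^sub>y\<close> put \<open>T\<^sub>\<phi>(X) = \<Sum>\<^sub>x\<^sub>,\<^sub>y \<phi>(x,y) P\<^sub>x X Q\<^sub>y\<close>. If \<open>\<phi>\<close> is
  the divided difference of \<open>f\<close>, then \<open>f(A) - f(B) = T\<^sub>\<phi>(A - B)\<close> exactly. Since \<open>T\<^sub>\<phi>(X)\<close> is continuous in \<open>A\<close>,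
  \<open>B\<close> and \<open>X\<close> (clear for polynomial \<open>\<phi>\<close>, hence for continuous \<open>\<phi>\<close> by Stone--Weierstrass), the derivative
  of \<open>f\<close> at \<open>A\<close> is \<open>T\<^sub>\<phi>\<close> with \<open>B = A\<close>.

  Let \<open>K(s,u) = Tr (\<rho>(s)\<^sup>\<alpha> \<rho>(u)\<^sup>\<beta>)\<close> with \<open>\<beta> = 1 - \<alpha>\<close>. The derivative of \<open>K\<close> in \<open>u\<close> at \<open>u = s\<close> is
  \<open>\<beta> Tr \<partial>\<rho> = 0\<close> because the trace is constant. Differentiating this identity along the diagonal turns
  the Hessian in \<open>u\<close> into minus the mixed derivative, a product of two first derivatives: second divided
  differences never appear, and \<open>\<zeta>\<close> arises as a product of divided differences of \<open>x\<^sup>\<alpha>\<close> and \<open>x\<^sup>\<beta>\<close>.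
  The logarithm does not contribute, as \<open>K = 1\<close> and \<open>\<partial>K = 0\<close> on the diagonal.
\<close>

section \<open>Spectral decomposition of Hermitian matrices\<close>

text \<open>A maximiser \<open>v\<close> of the quadratic form on the unit sphere of
  \<open>S\<close> is an eigenvector. The residual \<open>w = f v - m *\<^sub>R v\<close> lies in
  \<open>S\<close> and is orthogonal to \<open>v\<close>. Moving from \<open>v\<close> along
  \<open>w\<close> changes the form to first order by \<open>2 * t * (w \<bullet> w)\<close>, which
  maximality permits only if \<open>w = 0\<close>.\<close>

lemma symmetric_invariant_subspace_eigenvector:
  fixes f :: "'a::euclidean_space \<Rightarrow> 'a"
  assumes f: "linear f" and sym: "\<And>v w. v \<bullet> f w = f v \<bullet> w"
    and S: "subspace S" "S \<noteq> {0}" and inv: "\<And>v. v \<in> S \<Longrightarrow> f v \<in> S"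
  obtains v c where "v \<in> S" "v \<noteq> 0" "f v = c *\<^sub>R v"
proof -
  interpret linear f by (fact f)
  obtain u where u: "u \<in> S" "u \<noteq> 0"
    using S subspace_0 by blast
  let ?K = "S \<inter> sphere 0 1"
  have "compact ?K"
    using closed_subspace[OF S(1)] by (simp add: closed_Int_compact)
  moreover have "(1 / norm u) *\<^sub>R u \<in> ?K"
    using u S(1) by (simp add: subspace_scale)
  moreover have "continuous_on ?K (\<lambda>v. v \<bullet> f v)"
    by (intro continuous_intros linear_continuous_on linear_conv_bounded_linear[THEN iffD1] f)
  ultimately obtain v where v: "v \<in> ?K" and max: "\<And>w. w \<in> ?K \<Longrightarrow> w \<bullet> f w \<le> v \<bullet> f v"
    using continuous_attains_sup[of ?K "\<lambda>v. v \<bullet> f v"] by blast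
  define m where "m = v \<bullet> f v"
  have vS: "v \<in> S" and vv: "v \<bullet> v = 1"
    using v by (auto simp: dot_square_norm)
  have le: "w \<bullet> f w \<le> m * (w \<bullet> w)" if "w \<in> S" for w
  proof (cases "w = 0")
    case False
    have "(1 / norm w) *\<^sub>R w \<in> ?K"
      using that S(1) False by (simp add: subspace_scale)
    from max[OF this] have "(w \<bullet> f w) / (norm w)\<^sup>2 \<le> m"
      by (simp add: scale m_def power2_eq_square)
    then show ?thesis
      using False by (simp add: dot_square_norm divide_le_eq)
  qed (simp add: zero)
  define w where "w = f v - m *\<^sub>R v"
  have wS: "w \<in> S"
    unfolding w_def using S(1) vS inv by (simp add: subspace_diff subspace_scale)
  have wv: "w \<bullet> v = 0"
    unfolding w_def using vv by (simp add: m_def inner_diff_right inner_commute)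
  have fv: "f v = w + m *\<^sub>R v"
    by (simp add: w_def)
  \<comment> \<open>The absolute value and the summand 1 make \<open>C\<close> strictly positive, so
    that division by it is possible below.\<close>
  define C where "C = \<bar>m * (w \<bullet> w) - w \<bullet> f w\<bar> + 1"
  have C: "C > 0" by (simp add: C_def add_nonneg_pos)
  have bound: "2 * t * (w \<bullet> w) \<le> t\<^sup>2 * C" for t :: real
  proof -
    have "(v + t *\<^sub>R w) \<bullet> f (v + t *\<^sub>R w) \<le> m * ((v + t *\<^sub>R w) \<bullet> (v + t *\<^sub>R w))"
      by (rule le) (use S(1) vS wS in \<open>simp add: subspace_add subspace_scale\<close>)
    moreover have "(v + t *\<^sub>R w) \<bullet> f (v + t *\<^sub>R w) = m + 2 * t * (w \<bullet> w) + t\<^sup>2 * (w \<bullet> f w)"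
    proof -
      have "v \<bullet> f w = w \<bullet> w"
        using sym[of v w] wv by (simp add: fv inner_add_left inner_commute[of v w])
      moreover have "w \<bullet> f v = w \<bullet> w"
        using wv by (simp add: fv inner_add_right)
      moreover have "v \<bullet> f v = m"
        by (simp add: m_def)
      ultimately show ?thesis
        by (simp add: add scale inner_add_left inner_add_right power2_eq_square algebra_simps)
    qed
    moreover have "(v + t *\<^sub>R w) \<bullet> (v + t *\<^sub>R w) = 1 + t\<^sup>2 * (w \<bullet> w)"
      using wv vv by (simp add: inner_add_left inner_add_right inner_commute power2_eq_square)
    ultimately have "m + 2 * t * (w \<bullet> w) + t\<^sup>2 * (w \<bullet> f w) \<le> m * (1 + t\<^sup>2 * (w \<bullet> w))"
      by metis
    then have "2 * t * (w \<bullet> w) \<le> t\<^sup>2 * (m * (w \<bullet> w) - w \<bullet> f w)"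
      by (simp add: algebra_simps)
    also have "\<dots> \<le> t\<^sup>2 * C"
      by (intro mult_left_mono) (auto simp: C_def)
    finally show ?thesis .
  qed
  have "w \<bullet> w = 0"
  proof (rule ccontr)
    assume "w \<bullet> w \<noteq> 0"
    then have pos: "w \<bullet> w > 0" by simp
    \<comment> \<open>The choice \<open>t = w \<bullet> w / C\<close> makes the linear term twice
      the quadratic bound.\<close>
    have "2 * (w \<bullet> w / C) * (w \<bullet> w) \<le> (w \<bullet> w / C)\<^sup>2 * C" by (rule bound)
    also have "\<dots> = (w \<bullet> w / C) * (w \<bullet> w)"
      using C by (simp add: power2_eq_square)
    finally have "(w \<bullet> w / C) * (w \<bullet> w) \<le> 0" by simp
    moreover have "(w \<bullet> w / C) * (w \<bullet> w) > 0" using pos C by (intro mult_pos_pos divide_pos_pos)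
    ultimately show False by linarith
  qed
  then have "f v = m *\<^sub>R v" by (simp add: fv)
  moreover have "v \<noteq> 0" using vv by auto
  ultimately show thesis using that vS by blast
qed

text \<open>The orthogonal complement of all eigenvectors is invariant by symmetry. Were it nonzero,
  it would contain an eigenvector, which would be orthogonal to itself.\<close>

lemma span_eigenvectors_symmetric:
  fixes f :: "'a::euclidean_space \<Rightarrow> 'a"
  assumes f: "linear f" and sym: "\<And>v w. v \<bullet> f w = f v \<bullet> w"
  shows "span {v. \<exists>c. f v = c *\<^sub>R v} = UNIV"
proof (rule ccontr)
  interpret linear f by (fact f)
  let ?E = "{v. \<exists>c. f v = c *\<^sub>R v}"
  let ?S = "orthogonal_comp (span ?E)"
  assume ne: "span ?E \<noteq> UNIV"
  have inv: "f v \<in> ?S" if "v \<in> ?S" for v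
  proof -
    have "orthogonal y (f v)" if y: "y \<in> ?E" for y
    proof -
      obtain c where c: "f y = c *\<^sub>R y" using y by blast
      have "orthogonal y v"
        using \<open>v \<in> ?S\<close> span_base[OF y] by (simp add: orthogonal_comp_def)
      then show ?thesis
        by (simp add: orthogonal_def sym c)
    qed
    then have "orthogonal y (f v)" if "y \<in> span ?E" for y
      using orthogonal_to_span[OF that, of "f v"] by (simp add: orthogonal_commute)
    then show ?thesis
      by (simp add: orthogonal_comp_def)
  qed
  have "?S \<noteq> {0}"
    using ne orthogonal_comp_self[of "span ?E"] by auto
  then obtain v c where v: "v \<in> ?S" "v \<noteq> 0" "f v = c *\<^sub>R v"
    using symmetric_invariant_subspace_eigenvector[OF f sym subspace_orthogonal_comp _ inv]
    by blast
  then have "v \<in> span ?E"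
    by (auto intro: span_base)
  with v have "orthogonal v v"
    by (simp add: orthogonal_comp_def)
  with v(2) show False by (simp add: orthogonal_self)
qed

section \<open>Adjoints and the real inner product\<close>

definition adjoint_matrix :: "complex^'n^'m \<Rightarrow> complex^'m^'n" where
  "adjoint_matrix A = (\<chi> i j. cnj (A $ j $ i))"

lemma hermitian_iff_adjoint: "hermitian A \<longleftrightarrow> adjoint_matrix A = A"
  unfolding hermitian_def adjoint_matrix_def vec_eq_iff by (simp add: eq_commute)

lemma adjoint_matrix_mult: "adjoint_matrix (A ** B) = adjoint_matrix B ** adjoint_matrix A"
  by (simp add: adjoint_matrix_def matrix_matrix_mult_def vec_eq_iff mult.commute)

lemma adjoint_matrix_scaleR: "adjoint_matrix (c *\<^sub>R A) = c *\<^sub>R adjoint_matrix A"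
  by (simp add: adjoint_matrix_def vec_eq_iff)

lemma adjoint_matrix_sum: "adjoint_matrix (sum f I) = (\<Sum>i\<in>I. adjoint_matrix (f i))"
  by (simp add: adjoint_matrix_def vec_eq_iff)

lemma trace_adjoint_matrix: "trace (adjoint_matrix A) = cnj (trace A)"
  by (simp add: adjoint_matrix_def trace_def)

lemma inner_complex_Re: "inner x y = Re (cnj x * y)"
  by (simp add: inner_complex_def)

text \<open>Identifies the library's inner product of matrices with the real part of the
  Hilbert-Schmidt one. The library norm is therefore the Frobenius norm, to which the Pythagorean
  theorem applies later.\<close>

lemma inner_matrix_trace:
  fixes X Y :: "complex^'n^'m"
  shows "X \<bullet> Y = Re (trace (adjoint_matrix X ** Y))"
proof -
  have "Re (trace (adjoint_matrix X ** Y)) = (\<Sum>j\<in>UNIV. \<Sum>i\<in>UNIV. Re (cnj (X $ i $ j) * Y $ i $ j))"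
    by (simp add: trace_def adjoint_matrix_def matrix_matrix_mult_def)
  also have "\<dots> = (\<Sum>i\<in>UNIV. \<Sum>j\<in>UNIV. Re (cnj (X $ i $ j) * Y $ i $ j))"
    by (rule sum.swap)
  also have "\<dots> = X \<bullet> Y"
    by (simp add: inner_vec_def inner_complex_Re)
  finally show ?thesis by simp
qed

lemma inner_matrix_vector_adjoint:
  fixes A :: "complex^'n^'m"
  shows "v \<bullet> (A *v w) = (adjoint_matrix A *v v) \<bullet> w"
proof -
  have "v \<bullet> (A *v w) = (\<Sum>i\<in>UNIV. \<Sum>j\<in>UNIV. Re (cnj (v $ i) * (A $ i $ j * w $ j)))"
    by (simp add: inner_vec_def inner_complex_Re matrix_vector_mult_def sum_distrib_left del: times_complex.sel)
  also have "\<dots> = (\<Sum>j\<in>UNIV. \<Sum>i\<in>UNIV. Re (cnj (v $ i) * (A $ i $ j * w $ j)))"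
    by (rule sum.swap)
  also have "\<dots> = (adjoint_matrix A *v v) \<bullet> w"
    by (simp add: inner_vec_def inner_complex_Re matrix_vector_mult_def adjoint_matrix_def
        sum_distrib_left sum_distrib_right mult_ac Re_sum[symmetric] del: times_complex.sel Re_sum)
  finally show ?thesis .
qed

lemma hermitian_inner: "hermitian A \<Longrightarrow> v \<bullet> (A *v w) = (A *v v) \<bullet> w"
  by (simp add: inner_matrix_vector_adjoint hermitian_iff_adjoint)

text \<open>The real part of the Hermitian form is already nondegenerate, so symmetry with respect
  to it determines the adjoint.\<close>

lemma hermitian_of_inner:
  fixes A :: "complex^'n^'n"
  assumes "\<And>v w. v \<bullet> (A *v w) = (A *v v) \<bullet> w"
  shows "hermitian A"
proof -
  have "(adjoint_matrix A *v v - A *v v) \<bullet> w = 0" for v w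
    using assms[of v w] by (simp add: inner_matrix_vector_adjoint inner_diff_left)
  then have "adjoint_matrix A *v v = A *v v" for v
    by (metis inner_eq_zero_iff right_minus_eq)
  then show ?thesis
    by (simp add: hermitian_iff_adjoint matrix_eq)
qed

section \<open>Orthogonal projections onto complex subspaces\<close>

lemma inner_vector_scalar_mult:
  fixes v w :: "complex^'n"
  shows "v \<bullet> (c *s w) = (cnj c *s v) \<bullet> w"
  by (simp add: inner_vec_def inner_complex_Re mult_ac del: times_complex.sel)

lemma scaleR_eq_vector_scalar_mult: "r *\<^sub>R (v :: complex^'n) = complex_of_real r *s v"
  by (simp add: vec_eq_iff scaleR_conv_of_real[where 'a=complex])

text \<open>Equal ranges give \<open>P ** Q = Q\<close> and \<open>Q ** P = P\<close>; the adjoint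
  of the second identity is \<open>P ** Q = P\<close>.\<close>

lemma orth_projection_onto_unique:
  fixes P Q :: "complex^'n^'n"
  assumes "orth_projection_onto S P" "orth_projection_onto S Q"
  shows "P = Q"
proof -
  have absorb: "P ** Q = Q" if "orth_projection_onto S P" "orth_projection_onto S Q"
    for P Q :: "complex^'n^'n"
  proof -
    have "P *v (Q *v v) = Q *v v" for v
    proof -
      have "Q *v v \<in> range ((*v) P)"
        using that by (auto simp: orth_projection_onto_def)
      then obtain u where "Q *v v = P *v u" by blast
      then show ?thesis
        using that by (simp add: orth_projection_onto_def matrix_vector_mul_assoc)
    qed
    then show ?thesis
      by (simp add: matrix_eq matrix_vector_mul_assoc[symmetric])
  qed
  have "adjoint_matrix P = P" "adjoint_matrix Q = Q"
    using assms by (auto simp: orth_projection_onto_def hermitian_iff_adjoint)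
  then have "P = P ** Q"
    using absorb[OF assms(2,1)] adjoint_matrix_mult[of Q P] by simp
  then show ?thesis
    using absorb[OF assms] by simp
qed

text \<open>The library's orthogonal complement is taken for the real inner product. Closure of
  \<open>S\<close> under complex scalars passes to this complement, so the real orthogonal
  projection is complex linear and hence given by a matrix.\<close>

lemma orth_projection_onto_exists:
  fixes S :: "(complex^'n) set"
  assumes zero: "0 \<in> S" and add: "\<And>v w. v \<in> S \<Longrightarrow> w \<in> S \<Longrightarrow> v + w \<in> S"
    and scale: "\<And>c v. v \<in> S \<Longrightarrow> c *s v \<in> S"
  shows "\<exists>P. orth_projection_onto S P"
proof -
  have S: "subspace S"
    using assms by (auto simp: subspace_def scaleR_eq_vector_scalar_mult)
  let ?S' = "orthogonal_comp S"
  have S': "subspace ?S'" by (rule subspace_orthogonal_comp)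
  have "\<exists>y. y \<in> S \<and> v - y \<in> ?S'" for v
  proof -
    have "v \<in> S + ?S'" using subspace_sum_orthogonal_comp[OF S] by blast
    then obtain y z where "v = y + z" "y \<in> S" "z \<in> ?S'" by (auto elim: set_plus_elim)
    then show ?thesis by (auto intro!: exI[of _ y])
  qed
  then obtain p where p: "\<And>v. p v \<in> S" "\<And>v. v - p v \<in> ?S'" by metis
  have p_unique: "p v = y" if "y \<in> S" "v - y \<in> ?S'" for v y
  proof -
    have "p v - y \<in> S" using p that S by (simp add: subspace_diff)
    moreover have "p v - y = (v - y) - (v - p v)" by simp
    then have "p v - y \<in> ?S'" using p that S' subspace_diff by metis
    ultimately have "orthogonal (p v - y) (p v - y)" unfolding orthogonal_comp_def by blast
    then show ?thesis by (simp add: orthogonal_self)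
  qed
  \<comment> \<open>In the real inner product a complex scalar moves to the other side as its
    conjugate, and \<open>S\<close> absorbs it there.\<close>
  have scale': "c *s z \<in> ?S'" if "z \<in> ?S'" for c z
    using that scale by (auto simp: orthogonal_comp_def orthogonal_def inner_vector_scalar_mult)
  have "Vector_Spaces.linear (*s) (*s) p"
  proof (intro Vector_Spaces.linear_iff[THEN iffD2] conjI allI vec.vector_space_axioms)
    fix u v
    have "u + v - (p u + p v) = (u - p u) + (v - p v)" by simp
    then have "u + v - (p u + p v) \<in> ?S'" using p S' subspace_add by metis
    then show "p (u + v) = p u + p v" using p by (intro p_unique add) auto
  next
    fix c v
    have "c *s v - c *s p v = c *s (v - p v)" by (simp add: vector_ssub_ldistrib)
    then have "c *s v - c *s p v \<in> ?S'" using p scale' by metis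
    then show "p (c *s v) = c *s p v" using p by (intro p_unique scale) auto
  qed
  then have P: "matrix p *v v = p v" for v by (rule matrix_works)
  have p_id: "p v = v" if "v \<in> S" for v
    using that S' by (intro p_unique) (auto simp: subspace_0)
  have "hermitian (matrix p)"
  proof (rule hermitian_of_inner)
    fix v w
    have "p v \<bullet> (w - p w) = 0" "(v - p v) \<bullet> p w = 0"
      using p unfolding orthogonal_comp_def orthogonal_def by (blast, metis (mono_tags, lifting) inner_commute mem_Collect_eq)
    then show "v \<bullet> (matrix p *v w) = (matrix p *v v) \<bullet> w"
      by (simp add: P inner_diff_left inner_diff_right)
  qed
  moreover have "matrix p ** matrix p = matrix p"
    by (simp add: matrix_eq matrix_vector_mul_assoc[symmetric] P p p_id)
  moreover have "range ((*v) (matrix p)) = S"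
    using p(1) p_id by (auto simp: P image_iff) (metis)
  ultimately show ?thesis by (auto simp: orth_projection_onto_def)
qed

text \<open>Shows that the definite description behind \<open>eigenprojection\<close> denotes. If
  \<open>x\<close> is not an eigenvalue, the eigenspace is zero and so is the projection.\<close>

lemma eigenprojection: "orth_projection_onto (eigenspace A x) (eigenprojection A x)"
proof -
  have "\<exists>P. orth_projection_onto (eigenspace A x) P"
  proof (rule orth_projection_onto_exists)
    show "c *s v \<in> eigenspace A x" if "v \<in> eigenspace A x" for c v
      using that vector_scalar_commute[of A c v]
      by (simp add: eigenspace_def vector_smult_assoc mult.commute)
  qed (simp_all add: eigenspace_def matrix_vector_right_distrib vector_add_ldistrib)
  then have "\<exists>!P. orth_projection_onto (eigenspace A x) P"
    using orth_projection_onto_unique by blast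
  then show ?thesis
    unfolding eigenprojection_def by (rule theI')
qed

lemma hermitian_eigenprojection: "hermitian (eigenprojection A x)"
  and eigenprojection_idem: "eigenprojection A x ** eigenprojection A x = eigenprojection A x"
  using eigenprojection[of A x] unfolding orth_projection_onto_def by blast+

lemma eigenprojection_in_eigenspace: "eigenprojection A x *v v \<in> eigenspace A x"
  using eigenprojection[of A x] unfolding orth_projection_onto_def by blast

lemma eigenprojection_eigenvector:
  assumes "v \<in> eigenspace A x" shows "eigenprojection A x *v v = v"
proof -
  obtain u where "v = eigenprojection A x *v u"
    using assms eigenprojection[of A x] unfolding orth_projection_onto_def by blast
  then show ?thesis
    by (simp add: matrix_vector_mul_assoc eigenprojection_idem)
qed

lemma bounded_bilinear_matrix_mult:
  "bounded_bilinear ((**) :: complex^'m^'n \<Rightarrow> complex^'p^'m \<Rightarrow> complex^'p^'n)"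
  unfolding bilinear_conv_bounded_bilinear[symmetric] bilinear_def
  by (intro conjI allI linearI)
    (simp_all add: vec_eq_iff matrix_matrix_mult_def sum.distrib distrib_left distrib_right
      scaleR_sum_right)

interpretation matrix_mult: bounded_bilinear "(**) :: complex^'m^'n \<Rightarrow> complex^'p^'m \<Rightarrow> complex^'p^'n"
  by (rule bounded_bilinear_matrix_mult)

lemma bounded_linear_trace: "bounded_linear (trace :: complex^'n^'n \<Rightarrow> complex)"
  unfolding linear_conv_bounded_linear[symmetric]
  by (rule linearI) (simp_all add: trace_def sum.distrib scaleR_sum_right)

lemmas trace_sum = linear_sum[OF bounded_linear.linear[OF bounded_linear_trace]]
  and trace_scaleR = linear_scale[OF bounded_linear.linear[OF bounded_linear_trace]]

lemma scaleR_matrix_vector_mult: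
  fixes A :: "complex^'n^'m"
  shows "(c *\<^sub>R A) *v v = c *\<^sub>R (A *v v)"
  by (simp add: matrix_vector_mult_def vec_eq_iff scaleR_sum_right)

lemma mult_eigenprojection: "A ** eigenprojection A x = x *\<^sub>R eigenprojection A x"
  using eigenprojection_in_eigenspace[of A x]
  by (simp add: matrix_eq matrix_vector_mul_assoc[symmetric] eigenspace_def
      scaleR_eq_vector_scalar_mult[symmetric] scaleR_matrix_vector_mult)

lemma eigenprojection_mult:
  assumes "hermitian A"
  shows "eigenprojection A x ** A = x *\<^sub>R eigenprojection A x"
proof -
  have "adjoint_matrix (A ** eigenprojection A x) = adjoint_matrix (x *\<^sub>R eigenprojection A x)"
    by (simp only: mult_eigenprojection)
  then show ?thesis
    using assms hermitian_eigenprojection[of A x]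
    by (simp add: adjoint_matrix_mult adjoint_matrix_scaleR hermitian_iff_adjoint)
qed

text \<open>Placing \<open>A\<close> between the two projections produces the factor
  \<open>x\<close> when absorbed to the left and \<open>y\<close> when absorbed to the
  right.\<close>

lemma eigenprojection_orthogonal:
  assumes "hermitian A" "x \<noteq> y"
  shows "eigenprojection A x ** eigenprojection A y = 0"
proof -
  have "x *\<^sub>R (eigenprojection A x ** eigenprojection A y)
      = (eigenprojection A x ** A) ** eigenprojection A y"
    by (simp add: eigenprojection_mult assms matrix_mult.scaleR_left)
  also have "\<dots> = y *\<^sub>R (eigenprojection A x ** eigenprojection A y)"
    by (simp add: matrix_mul_assoc[symmetric] mult_eigenprojection matrix_mult.scaleR_right)
  finally show ?thesis using assms(2) by simp
qed

text \<open>One eigenvector per eigenvalue gives an orthogonal family of nonzero vectors, which is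
  independent and therefore finite.\<close>

lemma finite_eigenvalues:
  fixes A :: "complex^'n^'n"
  assumes "hermitian A"
  shows "finite (eigenvalues A)"
proof -
  have "\<forall>x\<in>eigenvalues A. \<exists>v. v \<noteq> 0 \<and> v \<in> eigenspace A x"
    by (simp add: eigenvalues_def)
  then obtain w where w: "\<And>x. x \<in> eigenvalues A \<Longrightarrow> w x \<noteq> 0 \<and> w x \<in> eigenspace A x"
    by metis
  have orth: "w x \<bullet> w y = 0" if "x \<in> eigenvalues A" "y \<in> eigenvalues A" "x \<noteq> y" for x y
  proof -
    have "w x \<bullet> w y = (eigenprojection A x *v w x) \<bullet> (eigenprojection A y *v w y)"
      using w that by (simp add: eigenprojection_eigenvector)
    also have "\<dots> = w x \<bullet> ((eigenprojection A x ** eigenprojection A y) *v w y)"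
      by (simp add: hermitian_inner hermitian_eigenprojection matrix_vector_mul_assoc[symmetric])
    finally show ?thesis by (simp add: eigenprojection_orthogonal assms that)
  qed
  have "inj_on w (eigenvalues A)"
    by (rule inj_onI) (metis w orth inner_eq_zero_iff)
  moreover have "independent (w ` eigenvalues A)"
    by (rule pairwise_orthogonal_independent)
      (use w orth in \<open>auto simp: pairwise_def orthogonal_def\<close>)
  ultimately show ?thesis
    using independent_imp_finite finite_image_iff by blast
qed

text \<open>The sum fixes every eigenvector, and the eigenvectors span the space.\<close>

lemma sum_eigenprojection:
  fixes A :: "complex^'n^'n"
  assumes A: "hermitian A"
  shows "(\<Sum>x\<in>eigenvalues A. eigenprojection A x) = mat 1"
proof -
  let ?Q = "\<Sum>x\<in>eigenvalues A. eigenprojection A x"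
  have "?Q *v v = v" if v: "v \<in> eigenspace A c" "v \<noteq> 0" for v c
  proof -
    have c: "c \<in> eigenvalues A" using v by (auto simp: eigenvalues_def)
    have "?Q ** eigenprojection A c
        = (\<Sum>x\<in>eigenvalues A. if x = c then eigenprojection A c else 0)"
      unfolding matrix_mult.sum_left
      by (intro sum.cong refl) (simp add: eigenprojection_idem eigenprojection_orthogonal A)
    also have "\<dots> = eigenprojection A c" using c finite_eigenvalues[OF A] by simp
    finally have "?Q *v (eigenprojection A c *v v) = eigenprojection A c *v v"
      by (simp add: matrix_vector_mul_assoc)
    then show ?thesis using v by (simp add: eigenprojection_eigenvector)
  qed
  then have ev: "?Q *v v = v" if "A *v v = c *\<^sub>R v" for v c
    using that by (cases "v = 0") (auto simp: eigenspace_def scaleR_eq_vector_scalar_mult)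
  \<comment> \<open>This is the real span; it suffices because two real linear maps that agree on a
    spanning set are equal.\<close>
  have "span {v. \<exists>c. A *v v = c *\<^sub>R v} = UNIV"
    by (rule span_eigenvectors_symmetric) (simp_all add: hermitian_inner A)
  moreover have "linear ((*v) ?Q)" "linear (\<lambda>v :: complex^'n. v)"
    by (rule matrix_vector_mul_linear, rule linear_ident)
  ultimately have "?Q *v v = v" for v
    using ev linear_eq_on[of "(*v) ?Q" "\<lambda>v. v" v "{v. \<exists>c. A *v v = c *\<^sub>R v}"] by blast
  then show ?thesis by (simp add: matrix_eq)
qed

section \<open>Functional calculus and double operator sums\<close>

definition functional_calculus :: "(real \<Rightarrow> real) \<Rightarrow> complex^'n^'n \<Rightarrow> complex^'n^'n" where
  "functional_calculus f A = (\<Sum>x\<in>eigenvalues A. f x *\<^sub>R eigenprojection A x)"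

text \<open>The map \<open>T\<close> of the introduction, a finite-dimensional double operator
  integral. In eigenbases of \<open>A\<close> and \<open>B\<close> it multiplies the entries of
  \<open>X\<close> by the values of the symbol \<phi> at the corresponding eigenvalues, as a Schur
  multiplier does.\<close>

definition double_operator_sum ::
    "(real \<Rightarrow> real \<Rightarrow> real) \<Rightarrow> complex^'n^'n \<Rightarrow> complex^'n^'n \<Rightarrow> complex^'n^'n \<Rightarrow> complex^'n^'n" where
  "double_operator_sum \<phi> A B X = (\<Sum>x\<in>eigenvalues A. \<Sum>y\<in>eigenvalues B.
     \<phi> x y *\<^sub>R (eigenprojection A x ** X ** eigenprojection B y))"

lemma double_operator_sum_cong:
  assumes "\<And>x y. x \<in> eigenvalues A \<Longrightarrow> y \<in> eigenvalues B \<Longrightarrow> \<phi> x y = \<psi> x y"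
  shows "double_operator_sum \<phi> A B X = double_operator_sum \<psi> A B X"
  unfolding double_operator_sum_def using assms by (intro sum.cong) auto

lemma double_operator_sum_add:
  "double_operator_sum (\<lambda>x y. \<phi> x y + \<psi> x y) A B X =
     double_operator_sum \<phi> A B X + double_operator_sum \<psi> A B X"
  by (simp add: double_operator_sum_def scaleR_add_left sum.distrib)

lemma double_operator_sum_diff:
  "double_operator_sum (\<lambda>x y. \<phi> x y - \<psi> x y) A B X =
     double_operator_sum \<phi> A B X - double_operator_sum \<psi> A B X"
  by (simp add: double_operator_sum_def scaleR_diff_left sum_subtractf)

lemma double_operator_sum_cmult:
  "double_operator_sum (\<lambda>x y. c * \<phi> x y) A B X = c *\<^sub>R double_operator_sum \<phi> A B X"
  by (simp add: double_operator_sum_def scaleR_sum_right)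

lemma double_operator_sum_scaleR_right:
  "double_operator_sum \<phi> A B (c *\<^sub>R X) = c *\<^sub>R double_operator_sum \<phi> A B X"
  by (simp add: double_operator_sum_def scaleR_sum_right matrix_mult.scaleR_right
      matrix_mult.scaleR_left mult.commute)

lemma eigenprojection_mult_double_operator_sum:
  assumes "hermitian A" "x \<in> eigenvalues A"
  shows "eigenprojection A x ** double_operator_sum \<phi> A B X =
    (\<Sum>y\<in>eigenvalues B. \<phi> x y *\<^sub>R (eigenprojection A x ** X ** eigenprojection B y))"
proof -
  have "eigenprojection A x ** double_operator_sum \<phi> A B X =
    (\<Sum>x'\<in>eigenvalues A. if x' = x then
      (\<Sum>y\<in>eigenvalues B. \<phi> x y *\<^sub>R (eigenprojection A x ** X ** eigenprojection B y)) else 0)"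
    unfolding double_operator_sum_def matrix_mult.sum_right matrix_mult.scaleR_right
    using assms(1)
    by (intro sum.cong refl)
      (auto simp: matrix_mul_assoc eigenprojection_idem eigenprojection_orthogonal)
  then show ?thesis using assms finite_eigenvalues[OF assms(1)] by simp
qed

lemma sum_eigenprojection_mult_eigenprojection:
  assumes "hermitian B" "y \<in> eigenvalues B"
  shows "(\<Sum>y'\<in>eigenvalues B. c y' *\<^sub>R (X ** eigenprojection B y')) ** eigenprojection B y =
    c y *\<^sub>R (X ** eigenprojection B y)"
proof -
  have "(\<Sum>y'\<in>eigenvalues B. c y' *\<^sub>R (X ** eigenprojection B y')) ** eigenprojection B y =
    (\<Sum>y'\<in>eigenvalues B. if y' = y then c y *\<^sub>R (X ** eigenprojection B y) else 0)"
    unfolding matrix_mult.sum_left matrix_mult.scaleR_left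
    using assms(1)
    by (intro sum.cong refl)
      (auto simp: matrix_mul_assoc[symmetric] eigenprojection_idem eigenprojection_orthogonal)
  then show ?thesis using assms finite_eigenvalues[OF assms(1)] by simp
qed

text \<open>Relative to the blocks cut out by the eigenprojections, the operator sum acts
  diagonally. Its composition rule and the trace formulas rest on this.\<close>

lemma eigenprojection_double_operator_sum_eigenprojection:
  assumes "hermitian A" "hermitian B" "x \<in> eigenvalues A" "y \<in> eigenvalues B"
  shows "eigenprojection A x ** double_operator_sum \<phi> A B X ** eigenprojection B y =
    \<phi> x y *\<^sub>R (eigenprojection A x ** X ** eigenprojection B y)"
  using assms
  by (simp add: eigenprojection_mult_double_operator_sum sum_eigenprojection_mult_eigenprojection)

text \<open>Products of symbols become compositions of maps; this is what carries the product case
  of the induction over polynomial symbols.\<close>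

lemma double_operator_sum_mult:
  assumes "hermitian A" "hermitian B"
  shows "double_operator_sum (\<lambda>x y. \<phi> x y * \<psi> x y) A B X =
    double_operator_sum \<phi> A B (double_operator_sum \<psi> A B X)"
  unfolding double_operator_sum_def[of "\<lambda>x y. \<phi> x y * \<psi> x y"] double_operator_sum_def[of \<phi>]
  using assms
  by (intro sum.cong refl) (simp add: eigenprojection_double_operator_sum_eigenprojection)

lemma double_operator_sum_product:
  "double_operator_sum (\<lambda>x y. f x * g y) A B X =
     functional_calculus f A ** X ** functional_calculus g B"
  by (simp add: double_operator_sum_def functional_calculus_def matrix_mult.sum_left
      matrix_mult.sum_right matrix_mult.scaleR_left matrix_mult.scaleR_right scaleR_sum_right
      mult.commute sum.swap[of _ _ "eigenvalues A"])

lemma functional_calculus_1: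
  "hermitian A \<Longrightarrow> functional_calculus (\<lambda>_. 1) A = mat 1"
  by (simp add: functional_calculus_def sum_eigenprojection)

lemma functional_calculus_id:
  assumes "hermitian A"
  shows "functional_calculus (\<lambda>x. x) A = A"
proof -
  have "functional_calculus (\<lambda>x. x) A = A ** (\<Sum>x\<in>eigenvalues A. eigenprojection A x)"
    by (simp add: functional_calculus_def matrix_mult.sum_right mult_eigenprojection)
  then show ?thesis by (simp add: sum_eigenprojection assms)
qed

lemma double_operator_sum_left:
  "hermitian B \<Longrightarrow> double_operator_sum (\<lambda>x y. f x) A B X = functional_calculus f A ** X"
  using double_operator_sum_product[of f "\<lambda>_. 1" A B X] by (simp add: functional_calculus_1)

lemma double_operator_sum_right:
  "hermitian A \<Longrightarrow> double_operator_sum (\<lambda>x y. g y) A B X = X ** functional_calculus g B"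
  using double_operator_sum_product[of "\<lambda>_. 1" g A B X] by (simp add: functional_calculus_1)

lemma double_operator_sum_const:
  assumes "hermitian A" "hermitian B"
  shows "double_operator_sum (\<lambda>x y. c) A B X = c *\<^sub>R X"
  using double_operator_sum_cmult[of c "\<lambda>_ _. 1" A B X]
    double_operator_sum_left[OF assms(2), of "\<lambda>_. 1"] functional_calculus_1[OF assms(1)]
  by simp

text \<open>The symbol \<open>f x - f y\<close>, applied to the identity matrix, gives the left
  side. Factoring it as \<open>\<phi> x y * (x - y)\<close> splits off the map with symbol
  \<open>x - y\<close>, which sends the identity to \<open>A - B\<close>. The formula is exact even
  when \<open>A\<close> and \<open>B\<close> do not commute.\<close>

lemma functional_calculus_diff:
  assumes A: "hermitian A" and B: "hermitian B"
    and \<phi>: "\<And>x y. x \<in> eigenvalues A \<Longrightarrow> y \<in> eigenvalues B \<Longrightarrow> f x - f y = \<phi> x y * (x - y)"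
  shows "functional_calculus f A - functional_calculus f B = double_operator_sum \<phi> A B (A - B)"
proof -
  have "functional_calculus f A - functional_calculus f B =
      double_operator_sum (\<lambda>x y. f x - f y) A B (mat 1)"
    by (simp add: double_operator_sum_diff double_operator_sum_left[OF B]
        double_operator_sum_right[OF A])
  also have "\<dots> = double_operator_sum (\<lambda>x y. \<phi> x y * (x - y)) A B (mat 1)"
    by (intro double_operator_sum_cong \<phi>)
  also have "\<dots> = double_operator_sum \<phi> A B (A - B)"
    by (simp add: double_operator_sum_mult A B double_operator_sum_diff functional_calculus_id
        double_operator_sum_left[OF B, of "\<lambda>x. x"] double_operator_sum_right[OF A, of "\<lambda>x. x"])
  finally show ?thesis .
qed

section \<open>Norm of double operator sums\<close>

lemma inner_eigenprojection_orthogonal: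
  assumes A: "hermitian A" and B: "hermitian B" and ne: "(x, y) \<noteq> (x', y')"
  shows "(eigenprojection A x ** X ** eigenprojection B y) \<bullet>
    (eigenprojection A x' ** Y ** eigenprojection B y') = 0"
proof -
  let ?P = "eigenprojection A" and ?Q = "eigenprojection B"
  have adj: "adjoint_matrix (?P x) = ?P x" "adjoint_matrix (?Q y) = ?Q y"
    using hermitian_eigenprojection hermitian_iff_adjoint by blast+
  have "trace (adjoint_matrix (?P x ** X ** ?Q y) ** (?P x' ** Y ** ?Q y'))
      = trace (?Q y ** (adjoint_matrix X ** (?P x ** ?P x') ** Y ** ?Q y'))"
    by (simp add: adjoint_matrix_mult adj matrix_mul_assoc)
  \<comment> \<open>Cyclicity of the trace brings the projections of \<open>B\<close> together as
    well, so that one of the two products of eigenprojections vanishes.\<close>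
  also have "\<dots> = trace (adjoint_matrix X ** (?P x ** ?P x') ** Y ** (?Q y' ** ?Q y))"
    by (subst trace_mul_sym) (simp add: matrix_mul_assoc)
  also have "\<dots> = 0"
  proof (cases "x = x'")
    case True
    then have "?Q y' ** ?Q y = 0"
      using ne by (intro eigenprojection_orthogonal B) auto
    then show ?thesis by (simp add: trace_def)
  next
    case False
    then have "?P x ** ?P x' = 0"
      by (intro eigenprojection_orthogonal A)
    then show ?thesis by (simp add: trace_def)
  qed
  finally show ?thesis by (simp add: inner_matrix_trace)
qed

lemma norm_double_operator_sum_squared:
  assumes A: "hermitian A" and B: "hermitian B"
  shows "(norm (double_operator_sum \<phi> A B X))\<^sup>2 = (\<Sum>x\<in>eigenvalues A. \<Sum>y\<in>eigenvalues B.
     (\<phi> x y)\<^sup>2 * (norm (eigenprojection A x ** X ** eigenprojection B y))\<^sup>2)"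
proof -
  let ?f = "\<lambda>p. \<phi> (fst p) (snd p) *\<^sub>R (eigenprojection A (fst p) ** X ** eigenprojection B (snd p))"
  let ?I = "eigenvalues A \<times> eigenvalues B"
  have "(norm (sum ?f ?I))\<^sup>2 = (\<Sum>p\<in>?I. (norm (?f p))\<^sup>2)"
    by (rule norm_sum_Pythagorean)
      (auto simp: pairwise_def orthogonal_def inner_eigenprojection_orthogonal A B finite_eigenvalues)
  moreover have "sum ?f ?I = double_operator_sum \<phi> A B X"
    by (simp add: double_operator_sum_def sum.cartesian_product split_def)
  ultimately show ?thesis
    by (simp add: sum.cartesian_product split_def power_mult_distrib)
qed

text \<open>Blockwise comparison with the constant symbol \<open>c\<close>, whose operator sum is
  \<open>c *\<^sub>R X\<close>. The bound does not involve the number of eigenvalues, so uniform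
  approximation of symbols yields uniform approximation of the sums.\<close>

lemma norm_double_operator_sum_le:
  assumes A: "hermitian A" and B: "hermitian B" and "0 \<le> c"
    and c: "\<And>x y. x \<in> eigenvalues A \<Longrightarrow> y \<in> eigenvalues B \<Longrightarrow> \<bar>\<phi> x y\<bar> \<le> c"
  shows "norm (double_operator_sum \<phi> A B X) \<le> c * norm X"
proof -
  have "(\<phi> x y)\<^sup>2 \<le> c\<^sup>2" if "x \<in> eigenvalues A" "y \<in> eigenvalues B" for x y
    using c[OF that] by (metis abs_ge_zero power2_abs power_mono)
  then have "(norm (double_operator_sum \<phi> A B X))\<^sup>2 \<le> (norm (double_operator_sum (\<lambda>_ _. c) A B X))\<^sup>2"
    unfolding norm_double_operator_sum_squared[OF A B]
    by (intro sum_mono mult_right_mono) auto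
  also have "\<dots> = (c * norm X)\<^sup>2"
    using \<open>0 \<le> c\<close> by (simp add: double_operator_sum_const A B)
  finally show ?thesis
    by (rule power2_le_imp_le) (simp add: \<open>0 \<le> c\<close>)
qed

section \<open>Hermiticity and traces\<close>

lemma hermitian_functional_calculus: "hermitian (functional_calculus f A)"
  using hermitian_eigenprojection[of A]
  by (simp add: hermitian_iff_adjoint functional_calculus_def adjoint_matrix_sum adjoint_matrix_scaleR)

lemma hermitian_double_operator_sum:
  assumes "hermitian X" "\<And>x y. \<phi> x y = \<phi> y x"
  shows "hermitian (double_operator_sum \<phi> A A X)"
proof -
  have "adjoint_matrix (double_operator_sum \<phi> A A X) = (\<Sum>x\<in>eigenvalues A. \<Sum>y\<in>eigenvalues A.
     \<phi> y x *\<^sub>R (eigenprojection A y ** X ** eigenprojection A x))"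
    using hermitian_eigenprojection[of A] assms(2)
    by (simp add: double_operator_sum_def adjoint_matrix_sum adjoint_matrix_scaleR
        adjoint_matrix_mult hermitian_iff_adjoint assms(1)[unfolded hermitian_iff_adjoint]
        matrix_mul_assoc)
  also have "\<dots> = double_operator_sum \<phi> A A X"
    unfolding double_operator_sum_def by (rule sum.swap)
  finally show ?thesis by (simp add: hermitian_iff_adjoint)
qed

text \<open>Conjugating the trace reverses the product, and cyclicity restores the order. This later
  removes the \<open>Re\<close> that comes from the entropy.\<close>

lemma trace_mult_hermitian_real:
  assumes "hermitian A" "hermitian B"
  shows "complex_of_real (Re (trace (A ** B))) = trace (A ** B)"
proof -
  have "cnj (trace (A ** B)) = trace (adjoint_matrix (A ** B))"
    by (simp add: trace_adjoint_matrix)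
  also have "\<dots> = trace (A ** B)"
    using assms trace_mul_sym[of B A] by (simp add: adjoint_matrix_mult hermitian_iff_adjoint)
  finally show ?thesis
    by (simp add: Reals_cnj_iff)
qed

text \<open>By cyclicity a block at \<open>(x, y)\<close> of the first factor meets only the block
  at \<open>(y, x)\<close> of the second, whence the transposed arguments of \<psi>.\<close>

lemma trace_double_operator_sum_mult:
  assumes A: "hermitian A"
  shows "trace (double_operator_sum \<phi> A A X ** double_operator_sum \<psi> A A Y) =
    (\<Sum>x\<in>eigenvalues A. \<Sum>y\<in>eigenvalues A. complex_of_real (\<phi> x y * \<psi> y x) *
       trace (eigenprojection A x ** X ** eigenprojection A y ** Y))"
proof -
  let ?P = "eigenprojection A"
  have summand: "trace ((?P x ** X ** ?P y) ** double_operator_sum \<psi> A A Y)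
      = complex_of_real (\<psi> y x) * trace (?P x ** X ** ?P y ** Y)"
    if "x \<in> eigenvalues A" "y \<in> eigenvalues A" for x y
  proof -
    let ?D = "double_operator_sum \<psi> A A Y"
    \<comment> \<open>A second copy of \<open>?P x\<close>, supplied by idempotence, is cycled to
      the far end so that \<open>?D\<close> stands between two projections.\<close>
    have "trace ((?P x ** X ** ?P y) ** ?D) = trace (?P x ** (?P x ** X ** ?P y ** ?D))"
      by (simp add: matrix_mul_assoc eigenprojection_idem)
    also have "\<dots> = trace (?P x ** X ** (?P y ** ?D ** ?P x))"
      by (subst trace_mul_sym) (simp add: matrix_mul_assoc)
    also have "\<dots> = \<psi> y x *\<^sub>R trace (?P x ** X ** ?P y ** Y ** ?P x)"
      by (simp add: eigenprojection_double_operator_sum_eigenprojection A that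
          matrix_mult.scaleR_right trace_scaleR matrix_mul_assoc)
    also have "trace (?P x ** X ** ?P y ** Y ** ?P x) = trace (?P x ** X ** ?P y ** Y)"
      by (subst trace_mul_sym) (simp add: matrix_mul_assoc eigenprojection_idem)
    finally show ?thesis by (simp add: scaleR_conv_of_real)
  qed
  show ?thesis
    unfolding double_operator_sum_def[of \<phi>] matrix_mult.sum_left matrix_mult.scaleR_left
      trace_sum trace_scaleR
    by (intro sum.cong refl) (simp add: summand scaleR_conv_of_real)
qed

text \<open>Only diagonal blocks survive in the trace, so \<psi> enters through its diagonal values
  alone. For a divided difference these are values of the derivative.\<close>

lemma trace_functional_calculus_mult:
  assumes A: "hermitian A"
  shows "trace (functional_calculus f A ** double_operator_sum \<psi> A A Y) =
    trace (functional_calculus (\<lambda>x. f x * \<psi> x x) A ** Y)"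
proof -
  let ?P = "eigenprojection A"
  have summand: "trace (?P x ** double_operator_sum \<psi> A A Y) = \<psi> x x *\<^sub>R trace (?P x ** Y)"
    if "x \<in> eigenvalues A" for x
  proof -
    let ?D = "double_operator_sum \<psi> A A Y"
    have "trace (?P x ** ?D) = trace (?P x ** (?P x ** ?D))"
      by (simp add: matrix_mul_assoc eigenprojection_idem)
    also have "\<dots> = trace (?P x ** ?D ** ?P x)"
      by (subst trace_mul_sym) simp
    also have "\<dots> = \<psi> x x *\<^sub>R trace (?P x ** Y ** ?P x)"
      by (simp add: eigenprojection_double_operator_sum_eigenprojection A that trace_scaleR)
    also have "trace (?P x ** Y ** ?P x) = trace (?P x ** Y)"
      by (subst trace_mul_sym) (simp add: matrix_mul_assoc eigenprojection_idem)
    finally show ?thesis .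
  qed
  show ?thesis
    unfolding functional_calculus_def matrix_mult.sum_left matrix_mult.scaleR_left
      trace_sum trace_scaleR
    by (intro sum.cong refl) (simp add: summand)
qed

section \<open>Continuity and differentiability\<close>

lemma has_vector_derivative_iff_tendsto:
  fixes g :: "real \<Rightarrow> 'a::real_normed_vector"
  shows "(g has_vector_derivative D) (at t) \<longleftrightarrow> ((\<lambda>s. (g s - g t) /\<^sub>R (s - t)) \<longlongrightarrow> D) (at t)"
proof -
  have "norm (g s - g t - (s - t) *\<^sub>R D) / norm (s - t) = norm ((g s - g t) /\<^sub>R (s - t) - D)"
    if "s \<noteq> t" for s
  proof -
    have "(g s - g t) /\<^sub>R (s - t) - D = (g s - g t - (s - t) *\<^sub>R D) /\<^sub>R (s - t)"
      using that by (simp add: scaleR_diff_right)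
    then show ?thesis
      by (simp add: divide_inverse)
  qed
  then have "((\<lambda>s. norm (g s - g t - (s - t) *\<^sub>R D) / norm (s - t)) \<longlongrightarrow> 0) (at t) \<longleftrightarrow>
      ((\<lambda>s. norm ((g s - g t) /\<^sub>R (s - t) - D)) \<longlongrightarrow> 0) (at t)"
    by (intro filterlim_cong) (auto simp: eventually_at_filter)
  then show ?thesis
    by (simp add: has_vector_derivative_def has_derivative_iff_norm bounded_linear_scaleR_left
        tendsto_norm_zero_iff LIM_zero_iff)
qed

section \<open>Uniform bounds on spectra\<close>

lemma bounded_bilinear_matrix_vector_mult:
  "bounded_bilinear ((*v) :: complex^'m^'n \<Rightarrow> complex^'m \<Rightarrow> complex^'n)"
  unfolding bilinear_conv_bounded_bilinear[symmetric] bilinear_def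
  by (intro conjI allI linearI)
    (simp_all add: vec_eq_iff matrix_vector_mult_def sum.distrib distrib_left distrib_right
      scaleR_sum_right)

text \<open>Each eigenvalue is the quadratic form at a unit eigenvector. As a function of parameter
  and vector, the form is continuous and positive on the compact product of \<open>S\<close> with
  the unit sphere, so it is bounded and has a positive lower bound there.\<close>

lemma eigenvalues_bounds_compact:
  fixes A :: "'a::topological_space \<Rightarrow> complex^'n^'n"
  assumes S: "compact S" and cont: "continuous_on S A" and pd: "\<And>s. s \<in> S \<Longrightarrow> pos_definite (A s)"
  obtains a b where "0 < a" "\<And>s. s \<in> S \<Longrightarrow> eigenvalues (A s) \<subseteq> {a..b}"
proof -
  let ?K = "S \<times> sphere (0::complex^'n) 1"
  let ?q = "\<lambda>p. snd p \<bullet> (A (fst p) *v snd p)"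
  have K: "compact ?K" using S by (intro compact_Times) auto
  have "continuous_on ?K (\<lambda>p. A (fst p))"
    by (rule continuous_on_compose2[OF cont]) (auto intro: continuous_intros)
  then have q: "continuous_on ?K ?q"
    by (intro continuous_on_inner bounded_bilinear.continuous_on[OF bounded_bilinear_matrix_vector_mult]
        continuous_intros)
  have eig: "\<exists>p\<in>?K. fst p = s \<and> ?q p = x" if s: "s \<in> S" and x: "x \<in> eigenvalues (A s)" for s x
  proof -
    obtain v where v: "v \<noteq> 0" "A s *v v = x *\<^sub>R v"
      using x by (auto simp: eigenvalues_def eigenspace_def scaleR_eq_vector_scalar_mult)
    let ?u = "v /\<^sub>R norm v"
    have "A s *v ?u = x *\<^sub>R ?u"
      using v by (simp add: bounded_bilinear.scaleR_right[OF bounded_bilinear_matrix_vector_mult])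
    moreover have "?u \<bullet> ?u = 1" "norm ?u = 1"
      using v by (simp_all add: dot_square_norm)
    ultimately have "?u \<bullet> (A s *v ?u) = x" and "(s, ?u) \<in> ?K"
      using s by (metis inner_scaleR_right mult.right_neutral, simp)
    then have "(s, ?u) \<in> ?K" "?q (s, ?u) = x"
      by simp_all
    then show ?thesis by (metis fst_conv)
  qed
  obtain b where b: "\<And>p. p \<in> ?K \<Longrightarrow> \<bar>?q p\<bar> \<le> b"
    using compact_imp_bounded[OF compact_continuous_image[OF q K]]
    unfolding bounded_iff real_norm_def by blast
  obtain a where a: "0 < a" "\<And>p. p \<in> ?K \<Longrightarrow> a \<le> ?q p"
  proof (cases "?K = {}")
    case True
    \<comment> \<open>With an empty product there is nothing to bound, and 1 is an arbitrary
      positive number.\<close>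
    then show ?thesis using that[of 1] by auto
  next
    case False
    obtain p where p: "p \<in> ?K" "\<And>r. r \<in> ?K \<Longrightarrow> ?q p \<le> ?q r"
      using continuous_attains_inf[OF K False q] by blast
    have "0 < ?q p"
      using p(1) pd[of "fst p"] unfolding pos_definite_def
      by (metis mem_Times_iff mem_sphere_0 norm_zero zero_neq_one)
    then show ?thesis using that p by blast
  qed
  have "eigenvalues (A s) \<subseteq> {a..b}" if s: "s \<in> S" for s
  proof
    fix x assume "x \<in> eigenvalues (A s)"
    then obtain p where "p \<in> ?K" "?q p = x" using eig[OF s] by metis
    then show "x \<in> {a..b}" using a(2)[of p] b[of p] by auto
  qed
  then show thesis using that a(1) by blast
qed

lemma pos_definite_hermitian: "pos_definite A \<Longrightarrow> hermitian A"
  by (simp add: pos_definite_def)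

lemma eigenvalues_pos_definite:
  assumes "pos_definite A" "x \<in> eigenvalues A"
  shows "0 < x"
proof -
  obtain a b where "0 < a" "eigenvalues A \<subseteq> {a..b}"
    using eigenvalues_bounds_compact[of "{0 :: real}" "\<lambda>_. A"] assms(1) by auto
  then show ?thesis using assms(2) by fastforce
qed

section \<open>Continuity of double operator sums\<close>

lemma continuous_on_double_operator_sum_polynomial:
  fixes A B X :: "'a::topological_space \<Rightarrow> complex^'n^'n" and p :: "real \<times> real \<Rightarrow> real"
  assumes "real_polynomial_function p"
    and A: "continuous_on S A" and B: "continuous_on S B" and "continuous_on S X"
    and hA: "\<And>s. s \<in> S \<Longrightarrow> hermitian (A s)" and hB: "\<And>s. s \<in> S \<Longrightarrow> hermitian (B s)"
  shows "continuous_on S (\<lambda>s. double_operator_sum (\<lambda>x y. p (x, y)) (A s) (B s) (X s))"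
  using assms(1,4)
proof (induction arbitrary: X rule: real_polynomial_function.induct)
  case (linear f)
  \<comment> \<open>The coefficients of the linear functional \<open>f\<close> on the plane; its
    operator sum is \<open>u *\<^sub>R (A s ** X s) + v *\<^sub>R (X s ** B s)\<close>.\<close>
  define u v where "u = f (1, 0)" and "v = f (0, 1)"
  have f: "(\<lambda>x y. f (x, y)) = (\<lambda>x y. u * x + v * y)"
  proof (intro ext)
    fix x y
    have "f (x *\<^sub>R (1, 0) + y *\<^sub>R (0, 1)) = x * f (1, 0) + y * f (0, 1)"
      using linear(1) by (simp only: linear_simps real_scaleR_def)
    then show "f (x, y) = u * x + v * y" by (simp add: u_def v_def mult.commute)
  qed
  have eq: "u *\<^sub>R (A s ** X s) + v *\<^sub>R (X s ** B s) =
      double_operator_sum (\<lambda>x y. f (x, y)) (A s) (B s) (X s)" if s: "s \<in> S" for s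
    unfolding f double_operator_sum_add double_operator_sum_cmult
    using double_operator_sum_left[OF hB[OF s], of "\<lambda>x. x" "A s" "X s"]
      double_operator_sum_right[OF hA[OF s], of "\<lambda>x. x" "B s" "X s"]
    by (simp add: functional_calculus_id hA hB s)
  have "continuous_on S (\<lambda>s. u *\<^sub>R (A s ** X s) + v *\<^sub>R (X s ** B s))"
    by (intro continuous_on_add continuous_on_scaleR continuous_on_const matrix_mult.continuous_on
        A B linear)
  then show ?case by (rule continuous_on_eq) (rule eq)
next
  case (const c)
  have "continuous_on S (\<lambda>s. c *\<^sub>R X s)"
    by (intro continuous_intros const)
  then show ?case
    by (rule continuous_on_eq) (simp add: double_operator_sum_const hA hB)
next
  case (add f g)
  then show ?case
    unfolding double_operator_sum_add by (intro continuous_on_add) auto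
next
  case (mult f g)
  \<comment> \<open>The inner operator sum takes the place of \<open>X\<close>, which is why the
    induction generalises over \<open>X\<close>.\<close>
  have "continuous_on S (\<lambda>s. double_operator_sum (\<lambda>x y. f (x, y)) (A s) (B s)
      (double_operator_sum (\<lambda>x y. g (x, y)) (A s) (B s) (X s)))"
    by (rule mult.IH(1)[OF mult.IH(2)[OF mult.prems]])
  then show ?case
    by (rule continuous_on_eq) (simp add: double_operator_sum_mult hA hB)
qed

text \<open>Single eigenprojections may jump where eigenvalues cross, so continuity is not read off
  termwise. Compactness puts all spectra into one rectangle. There \<phi> is a uniform limit of
  polynomials, and the norm bound turns this into uniform convergence of continuous
  functions.\<close>

lemma continuous_on_double_operator_sum:
  fixes A B X :: "'a::topological_space \<Rightarrow> complex^'n^'n"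
  assumes S: "compact S"
    and A: "continuous_on S A" and B: "continuous_on S B" and X: "continuous_on S X"
    and pA: "\<And>s. s \<in> S \<Longrightarrow> pos_definite (A s)" and pB: "\<And>s. s \<in> S \<Longrightarrow> pos_definite (B s)"
    and \<phi>: "continuous_on ({0<..} \<times> {0<..}) (\<lambda>(x, y). \<phi> x y)"
  shows "continuous_on S (\<lambda>s. double_operator_sum \<phi> (A s) (B s) (X s))"
proof -
  obtain a b where ab: "0 < a" "\<And>s. s \<in> S \<Longrightarrow> eigenvalues (A s) \<subseteq> {a..b}"
    using eigenvalues_bounds_compact[OF S A pA] by blast
  obtain c d where cd: "0 < c" "\<And>s. s \<in> S \<Longrightarrow> eigenvalues (B s) \<subseteq> {c..d}"
    using eigenvalues_bounds_compact[OF S B pB] by blast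
  note herm = pA[THEN pos_definite_hermitian] pB[THEN pos_definite_hermitian]
  let ?R = "{a..b} \<times> {c..d}"
  have "continuous_on ?R (\<lambda>(x, y). \<phi> x y)"
    by (rule continuous_on_subset[OF \<phi>]) (use ab cd in auto)
  then have "\<exists>p. real_polynomial_function p \<and> (\<forall>z\<in>?R. \<bar>(case z of (x, y) \<Rightarrow> \<phi> x y) - p z\<bar> < inverse (Suc n))" for n
    using Stone_Weierstrass_real_polynomial_function[of ?R "\<lambda>(x, y). \<phi> x y" "inverse (Suc n)"]
    by (metis compact_Icc compact_Times inverse_positive_iff_positive of_nat_0_less_iff zero_less_Suc)
  then obtain p where p: "\<And>n. real_polynomial_function (p n)"
    and close: "\<And>n x y. x \<in> {a..b} \<Longrightarrow> y \<in> {c..d} \<Longrightarrow> \<bar>\<phi> x y - p n (x, y)\<bar> < inverse (Suc n)"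
    by (metis (no_types, lifting) SigmaI case_prod_conv)
  obtain M where M: "\<And>s. s \<in> S \<Longrightarrow> norm (X s) \<le> M"
    using compact_imp_bounded[OF compact_continuous_image[OF X S]] unfolding bounded_iff by blast
  let ?T = "\<lambda>n s. double_operator_sum (\<lambda>x y. p n (x, y)) (A s) (B s) (X s)"
  let ?L = "\<lambda>s. double_operator_sum \<phi> (A s) (B s) (X s)"
  have bound: "norm (?T n s - ?L s) \<le> inverse (Suc n) * M" if s: "s \<in> S" for n s
  proof -
    have "norm (?L s - ?T n s) \<le> inverse (Suc n) * norm (X s)"
      unfolding double_operator_sum_diff[symmetric]
    proof (rule norm_double_operator_sum_le)
      fix x y assume "x \<in> eigenvalues (A s)" "y \<in> eigenvalues (B s)"
      then have "x \<in> {a..b}" "y \<in> {c..d}" using ab(2) cd(2) s by blast+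
      from close[OF this, of n] show "\<bar>\<phi> x y - p n (x, y)\<bar> \<le> inverse (Suc n)" by linarith
    qed (use herm s in auto)
    also have "\<dots> \<le> inverse (Suc n) * M"
      using M[OF s] by (intro mult_left_mono) auto
    finally show ?thesis by (simp add: norm_minus_commute)
  qed
  have lim: "(\<lambda>n. inverse (Suc n) * M) \<longlonglongrightarrow> 0"
    using tendsto_mult_left_zero[OF LIMSEQ_inverse_real_of_nat] by simp
  have "uniform_limit S ?T ?L sequentially"
  proof (rule uniform_limitI)
    fix e :: real assume "0 < e"
    then have "\<forall>\<^sub>F n in sequentially. inverse (Suc n) * M < e"
      by (rule order_tendstoD(2)[OF lim])
    then show "\<forall>\<^sub>F n in sequentially. \<forall>s\<in>S. dist (?T n s) (?L s) < e"
    proof eventually_elim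
      case (elim n)
      show ?case
        unfolding dist_norm using bound[of _ n] elim order_le_less_trans by blast
    qed
  qed
  moreover have "continuous_on S (?T n)" for n
    using continuous_on_double_operator_sum_polynomial[OF p A B X] herm by blast
  ultimately show ?thesis
    by (intro uniform_limit_theorem[of S ?T sequentially ?L]) auto
qed

section \<open>Divided differences\<close>

definition divided_difference :: "(real \<Rightarrow> real) \<Rightarrow> (real \<Rightarrow> real) \<Rightarrow> real \<Rightarrow> real \<Rightarrow> real" where
  "divided_difference f f' x y = (if x = y then f' x else (f x - f y) / (x - y))"

lemma divided_difference_commute: "divided_difference f f' x y = divided_difference f f' y x"
  by (simp add: divided_difference_def) (metis minus_diff_eq minus_divide_divide)

lemma divided_difference_mean_value:
  assumes S: "convex S" and f: "\<And>x. x \<in> S \<Longrightarrow> (f has_real_derivative f' x) (at x)"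
    and xy: "x \<in> S" "y \<in> S"
  obtains z where "z \<in> closed_segment x y" "divided_difference f f' x y = f' z"
proof -
  have lt: "\<exists>z\<in>closed_segment x y. divided_difference f f' x y = f' z"
    if xy: "x < y" "x \<in> S" "y \<in> S" for x y
  proof -
    have "{x..y} \<subseteq> S"
      using closed_segment_subset[OF xy(2,3) S] xy(1) by (simp add: closed_segment_eq_real_ivl)
    then obtain z where z: "x < z" "z < y" "f y - f x = (y - x) * f' z"
      using MVT2[OF xy(1), of f f'] f by (meson atLeastAtMost_iff subsetD)
    then have "divided_difference f f' y x = f' z"
      using xy(1) by (simp add: divided_difference_def)
    then show ?thesis
      using z by (intro bexI[of _ z])
        (auto simp: closed_segment_eq_real_ivl divided_difference_commute)
  qed
  have "\<exists>z\<in>closed_segment x y. divided_difference f f' x y = f' z"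
  proof (cases x y rule: linorder_cases)
    case less
    then show ?thesis using lt xy by blast
  next
    case equal
    then show ?thesis by (auto simp: divided_difference_def)
  next
    case greater
    then show ?thesis
      using lt[OF _ xy(2,1)] by (metis closed_segment_commute divided_difference_commute)
  qed
  then show thesis using that by blast
qed

text \<open>Off the diagonal this is a quotient of continuous functions. Near a diagonal point the
  mean value theorem expresses the value as \<open>f' z\<close> with \<open>z\<close> between the
  two coordinates, and convexity of balls keeps \<open>z\<close> close to that point.\<close>

lemma continuous_on_divided_difference:
  assumes S: "convex S" "open S" and f: "\<And>x. x \<in> S \<Longrightarrow> (f has_real_derivative f' x) (at x)"
    and f': "continuous_on S f'"
  shows "continuous_on (S \<times> S) (\<lambda>(x, y). divided_difference f f' x y)"
proof -
  have "isCont (\<lambda>(x, y). divided_difference f f' x y) (c, d)" if cd: "c \<in> S" "d \<in> S" for c d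
  proof (cases "c = d")
    case False
    have "isCont f c" "isCont f d" using f cd DERIV_isCont by blast+
    then have "isCont (\<lambda>p. (f (fst p) - f (snd p)) / (fst p - snd p)) (c, d)"
      using False by (intro continuous_intros isCont_o2[of _ fst f] isCont_o2[of _ snd f]) auto
    moreover have "\<forall>\<^sub>F p in nhds (c, d). fst p \<noteq> snd p"
    proof -
      have "open {p :: real \<times> real. fst p \<noteq> snd p}"
        by (intro open_Collect_neq continuous_intros)
      then show ?thesis
        using eventually_nhds_in_open[of "{p :: real \<times> real. fst p \<noteq> snd p}" "(c, d)"] False by simp
    qed
    then have "\<forall>\<^sub>F p in nhds (c, d). (f (fst p) - f (snd p)) / (fst p - snd p) =
        (\<lambda>(x, y). divided_difference f f' x y) p"
      by eventually_elim (simp add: divided_difference_def split_def)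
    ultimately show ?thesis
      by (rule isCont_cong[THEN iffD1, rotated])
  next
    case True
    have "isCont f' c"
      using continuous_on_interior[OF f'] cd S by (simp add: interior_open)
    show ?thesis
      unfolding continuous_at_eps_delta
    proof (intro allI impI)
      fix e :: real assume "0 < e"
      then obtain r where r: "0 < r" "\<And>z. dist z c < r \<Longrightarrow> dist (f' z) (f' c) < e"
        using \<open>isCont f' c\<close> unfolding continuous_at_eps_delta by blast
      obtain q where q: "0 < q" "ball c q \<subseteq> S"
        using S(2) cd openE by blast
      have "dist (case p of (x, y) \<Rightarrow> divided_difference f f' x y)
          (case (c, d) of (x, y) \<Rightarrow> divided_difference f f' x y) < e"
        if p: "dist p (c, d) < min r q" for p
      proof -
        have "dist (fst p) c < min r q" "dist (snd p) c < min r q"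
          using p True dist_fst_le[of p "(c, d)"] dist_snd_le[of p "(c, d)"] by auto
        then have b: "fst p \<in> ball c (min r q)" "snd p \<in> ball c (min r q)"
          by (auto simp: dist_commute)
        then have "fst p \<in> S" "snd p \<in> S" using q by auto
        then obtain z where z: "z \<in> closed_segment (fst p) (snd p)"
          "divided_difference f f' (fst p) (snd p) = f' z"
          using divided_difference_mean_value[OF S(1) f] by metis
        have "z \<in> ball c (min r q)"
          using z(1) closed_segment_subset[OF b] convex_ball by blast
        then have "dist z c < r" by (simp add: dist_commute)
        then have "dist (f' z) (f' c) < e" by (rule r(2))
        then show ?thesis
          using True z(2) by (simp add: split_def divided_difference_def[of f f' d d])
      qed
      then show "\<exists>d'>0. \<forall>x'. dist x' (c, d) < d' \<longrightarrow>
          dist (case x' of (x, y) \<Rightarrow> divided_difference f f' x y)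
          (case (c, d) of (x, y) \<Rightarrow> divided_difference f f' x y) < e"
        using r q by (intro exI[of _ "min r q"]) auto
    qed
  qed
  then show ?thesis
    by (intro continuous_at_imp_continuous_on) auto
qed

section \<open>The derivative of the functional calculus\<close>

lemma tendsto_double_operator_sum:
  fixes A B X :: "real \<Rightarrow> complex^'n^'n"
  assumes "continuous_on UNIV A" "continuous_on UNIV B" "continuous_on UNIV X"
    and "\<And>s. pos_definite (A s)" "\<And>s. pos_definite (B s)"
    and "continuous_on ({0<..} \<times> {0<..}) (\<lambda>(x, y). \<phi> x y)"
  shows "((\<lambda>s. double_operator_sum \<phi> (A s) (B s) (X s)) \<longlongrightarrow>
    double_operator_sum \<phi> (A t) (B t) (X t)) (at t)"
proof -
  \<comment> \<open>A compact neighbourhood of \<open>t\<close>, as the continuity theorem asks for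
    a compact parameter set; the radius 1 is arbitrary.\<close>
  have "continuous_on {t - 1..t + 1} (\<lambda>s. double_operator_sum \<phi> (A s) (B s) (X s))"
    using assms by (intro continuous_on_double_operator_sum) (auto intro: continuous_on_subset)
  then have "isCont (\<lambda>s. double_operator_sum \<phi> (A s) (B s) (X s)) t"
    by (rule continuous_on_interior) (simp add: interior_atLeastAtMost_real)
  then show ?thesis by (simp add: isCont_def)
qed

text \<open>The exact difference formula writes the difference quotient as an operator sum of the
  quotient of \<gamma>, with the second operator frozen at \<open>\<gamma> t\<close>. Continuity of
  operator sums then gives the limit.\<close>

lemma functional_calculus_has_vector_derivative:
  fixes \<gamma> :: "real \<Rightarrow> complex^'n^'n"
  assumes cont: "continuous_on UNIV \<gamma>" and pd: "\<And>s. pos_definite (\<gamma> s)"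
    and D: "(\<gamma> has_vector_derivative D) (at t)"
    and f: "\<And>x. 0 < x \<Longrightarrow> (f has_real_derivative f' x) (at x)" and f': "continuous_on {0<..} f'"
  shows "((\<lambda>s. functional_calculus f (\<gamma> s)) has_vector_derivative
    double_operator_sum (divided_difference f f') (\<gamma> t) (\<gamma> t) D) (at t)"
proof -
  let ?\<phi> = "divided_difference f f'"
  \<comment> \<open>Filling in \<open>D\<close> at \<open>s = t\<close> makes the difference
    quotient continuous on the whole line, so it may serve as the argument \<open>X\<close>.\<close>
  define q where "q s = (if s = t then D else (\<gamma> s - \<gamma> t) /\<^sub>R (s - t))" for s
  have "isCont q s" for s
  proof (cases "s = t")
    case True
    have "(q \<longlongrightarrow> D) (at t)"
      using D unfolding has_vector_derivative_iff_tendsto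
      by (rule Lim_transform_eventually) (auto simp: q_def eventually_at_filter)
    then show ?thesis using True by (simp add: isCont_def q_def)
  next
    case False
    have "isCont \<gamma> s" using cont by (simp add: continuous_on_eq_continuous_at)
    then have "isCont (\<lambda>s. (\<gamma> s - \<gamma> t) /\<^sub>R (s - t)) s"
      using False by (intro continuous_intros) auto
    moreover have "\<forall>\<^sub>F u in nhds s. (\<gamma> u - \<gamma> t) /\<^sub>R (u - t) = q u"
      using t1_space_nhds[OF False] by eventually_elim (simp add: q_def)
    ultimately show ?thesis by (rule isCont_cong[THEN iffD1, rotated])
  qed
  then have "continuous_on UNIV q"
    by (simp add: continuous_on_eq_continuous_at)
  moreover have "continuous_on ({0<..} \<times> {0<..}) (\<lambda>(x, y). ?\<phi> x y)"
    using f f' by (intro continuous_on_divided_difference) auto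
  ultimately have "((\<lambda>s. double_operator_sum ?\<phi> (\<gamma> s) (\<gamma> t) (q s)) \<longlongrightarrow>
      double_operator_sum ?\<phi> (\<gamma> t) (\<gamma> t) (q t)) (at t)"
    using cont pd by (intro tendsto_double_operator_sum[where B = "\<lambda>_. \<gamma> t"]) auto
  moreover have "q t = D" by (simp add: q_def)
  moreover have "double_operator_sum ?\<phi> (\<gamma> s) (\<gamma> t) (q s) =
      (functional_calculus f (\<gamma> s) - functional_calculus f (\<gamma> t)) /\<^sub>R (s - t)" if "s \<noteq> t" for s
    using functional_calculus_diff[of "\<gamma> s" "\<gamma> t" f ?\<phi>] pd[THEN pos_definite_hermitian] that
    by (simp add: q_def double_operator_sum_scaleR_right divided_difference_def)
  ultimately show ?thesis
    unfolding has_vector_derivative_iff_tendsto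
    by (auto elim!: Lim_transform_eventually simp: eventually_at_filter)
qed

section \<open>The Petz--Renyi information matrix\<close>

lemma bounded_linear_adjoint_matrix:
  "bounded_linear (adjoint_matrix :: complex^'n^'m \<Rightarrow> complex^'m^'n)"
  unfolding linear_conv_bounded_linear[symmetric]
  by (rule linearI) (simp_all add: adjoint_matrix_def vec_eq_iff)

lemma hermitian_vector_derivative:
  assumes "\<And>s. hermitian (\<gamma> s)" "(\<gamma> has_vector_derivative D) (at t)"
  shows "hermitian D"
proof -
  have "((\<lambda>s. adjoint_matrix (\<gamma> s)) has_vector_derivative adjoint_matrix D) (at t)"
    by (rule bounded_linear.has_vector_derivative[OF bounded_linear_adjoint_matrix assms(2)])
  then have "(\<gamma> has_vector_derivative adjoint_matrix D) (at t)"
    using assms(1) by (simp add: hermitian_iff_adjoint)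
  then show ?thesis
    using assms(2) by (simp add: hermitian_iff_adjoint vector_derivative_unique_at)
qed

lemma trace_vector_derivative_zero:
  fixes \<gamma> :: "real \<Rightarrow> complex^'n^'n"
  assumes "\<And>s. trace (\<gamma> s) = c" "(\<gamma> has_vector_derivative D) (at t)"
  shows "trace D = 0"
proof -
  have "((\<lambda>s. trace (\<gamma> s)) has_vector_derivative trace D) (at t)"
    by (rule bounded_linear.has_vector_derivative[OF bounded_linear_trace assms(2)])
  then have "((\<lambda>s::real. c) has_vector_derivative trace D) (at t)"
    using assms(1) by simp
  then show ?thesis
    using has_vector_derivative_const vector_derivative_unique_at by blast
qed

section \<open>Powers of positive definite matrices\<close>

lemma functional_calculus_mult:
  assumes "hermitian A"
  shows "functional_calculus f A ** functional_calculus g A = functional_calculus (\<lambda>x. f x * g x) A"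
  using double_operator_sum_mult[OF assms assms, of "\<lambda>x y. f x" "\<lambda>x y. g x" "mat 1"]
  by (simp add: double_operator_sum_left assms)

lemma functional_calculus_cong:
  "(\<And>x. x \<in> eigenvalues A \<Longrightarrow> f x = g x) \<Longrightarrow> functional_calculus f A = functional_calculus g A"
  by (simp add: functional_calculus_def)

definition powr_difference :: "real \<Rightarrow> real \<Rightarrow> real \<Rightarrow> real" where
  "powr_difference a = divided_difference (\<lambda>x. x powr a) (\<lambda>x. a * x powr (a - 1))"

lemma powr_difference_commute: "powr_difference a x y = powr_difference a y x"
  by (simp add: powr_difference_def divided_difference_commute)

lemma matrix_powr_eq: "matrix_powr A a = functional_calculus (\<lambda>x. x powr a) A"
  by (simp add: matrix_powr_def functional_calculus_def)

lemma matrix_powr_has_vector_derivative: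
  fixes \<gamma> :: "real \<Rightarrow> complex^'n^'n"
  assumes "continuous_on UNIV \<gamma>" "\<And>s. pos_definite (\<gamma> s)" "(\<gamma> has_vector_derivative D) (at t)"
  shows "((\<lambda>s. matrix_powr (\<gamma> s) a) has_vector_derivative
    double_operator_sum (powr_difference a) (\<gamma> t) (\<gamma> t) D) (at t)"
  unfolding matrix_powr_eq powr_difference_def
  by (rule functional_calculus_has_vector_derivative[OF assms])
    (auto intro!: derivative_eq_intros continuous_intros)

lemma continuous_on_powr_difference:
  "continuous_on ({0<..} \<times> {0<..}) (\<lambda>(x, y). powr_difference a x y)"
  unfolding powr_difference_def by (rule continuous_on_divided_difference) (auto intro!: derivative_eq_intros continuous_intros)

lemma matrix_powr_complement_mult:
  assumes "pos_definite A"
  shows "matrix_powr A a ** matrix_powr A (1 - a) = A"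
proof -
  have "functional_calculus (\<lambda>x. x powr a * x powr (1 - a)) A = functional_calculus (\<lambda>x. x) A"
    using eigenvalues_pos_definite[OF assms]
    by (intro functional_calculus_cong) (simp add: powr_add[symmetric] less_imp_le)
  then show ?thesis
    by (simp add: matrix_powr_eq functional_calculus_mult functional_calculus_id
        pos_definite_hermitian assms)
qed

text \<open>On the diagonal the divided difference is \<open>(1 - a) * x powr (- a)\<close>, and the
  factor \<open>x powr a\<close> cancels the power. A scalar remains, so the trace vanishes whenever
  \<open>Y\<close> is traceless.\<close>

lemma trace_matrix_powr_double_operator_sum:
  assumes "pos_definite A"
  shows "trace (matrix_powr A a ** double_operator_sum (powr_difference (1 - a)) A A Y) =
    (1 - a) *\<^sub>R trace Y"
proof -
  have "functional_calculus (\<lambda>x. x powr a * powr_difference (1 - a) x x) A =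
      functional_calculus (\<lambda>x. (1 - a) * 1) A"
  proof (rule functional_calculus_cong)
    fix x assume "x \<in> eigenvalues A"
    then have "0 < x" using eigenvalues_pos_definite assms by blast
    then have "x powr a * x powr (- a) = 1" by (simp add: powr_add[symmetric])
    then show "x powr a * powr_difference (1 - a) x x = (1 - a) * 1"
      by (simp add: powr_difference_def divided_difference_def)
  qed
  also have "\<dots> = (1 - a) *\<^sub>R mat 1"
    using functional_calculus_1[OF pos_definite_hermitian[OF assms]]
    by (simp add: functional_calculus_def scaleR_sum_right[symmetric])
  finally show ?thesis
    by (simp add: matrix_powr_eq trace_functional_calculus_mult pos_definite_hermitian assms
        matrix_mult.scaleR_left trace_scaleR)
qed

lemma bounded_linear_Re_trace_mult:
  "bounded_linear (\<lambda>X :: complex^'n^'n. Re (trace (A ** X)))"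
  by (intro bounded_linear_compose[OF bounded_linear_Re] bounded_linear_compose[OF bounded_linear_trace]
      matrix_mult.bounded_linear_right)

text \<open>The chain rule for the logarithm. Positivity of the trace is assumed only at
  \<open>t\<close>; for the Hessian it is supplied near the base point by continuity.\<close>

lemma petz_renyi_entropy_has_vector_derivative:
  fixes \<gamma> :: "real \<Rightarrow> complex^'n^'n"
  assumes \<gamma>: "continuous_on UNIV \<gamma>" "\<And>s. pos_definite (\<gamma> s)" "(\<gamma> has_vector_derivative D) (at t)"
    and pos: "0 < Re (trace (matrix_powr A \<alpha> ** matrix_powr (\<gamma> t) (1 - \<alpha>)))"
  shows "((\<lambda>s. petz_renyi_entropy \<alpha> A (\<gamma> s)) has_vector_derivative
    1 / (\<alpha> - 1) * (Re (trace (matrix_powr A \<alpha> ** double_operator_sum (powr_difference (1 - \<alpha>)) (\<gamma> t) (\<gamma> t) D))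
      / Re (trace (matrix_powr A \<alpha> ** matrix_powr (\<gamma> t) (1 - \<alpha>))))) (at t)"
proof -
  let ?F = "\<lambda>X. Re (trace (matrix_powr A \<alpha> ** X))"
  have "((\<lambda>s. ?F (matrix_powr (\<gamma> s) (1 - \<alpha>))) has_real_derivative
      ?F (double_operator_sum (powr_difference (1 - \<alpha>)) (\<gamma> t) (\<gamma> t) D)) (at t)"
    unfolding has_real_derivative_iff_has_vector_derivative
    by (rule bounded_linear.has_vector_derivative[OF bounded_linear_Re_trace_mult
        matrix_powr_has_vector_derivative[OF \<gamma>]])
  from DERIV_cmult[OF DERIV_chain2[OF DERIV_ln_divide[OF pos] this], of "1 / (\<alpha> - 1)"]
  show ?thesis
    unfolding petz_renyi_entropy_def has_real_derivative_iff_has_vector_derivative[symmetric]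
    by simp
qed

text \<open>Off the diagonal the two quotients share the denominator up to sign. On the diagonal the
  product of derivatives is \<open>\<alpha> * (1 - \<alpha>) / x\<close>. The order
  \<open>y x\<close> in the second factor fits the trace formula for two operator sums.\<close>

lemma petz_zeta_eq:
  assumes "0 < x" "0 < y" "\<alpha> \<noteq> 0" "\<alpha> \<noteq> 1"
  shows "petz_zeta \<alpha> x y =
    1 / (\<alpha> * (1 - \<alpha>)) * (powr_difference \<alpha> x y * powr_difference (1 - \<alpha>) y x)"
proof (cases "x = y")
  case True
  have "x powr (\<alpha> - 1) * x powr (- \<alpha>) = x powr (- 1)"
    by (simp add: powr_add[symmetric])
  then have "x powr (\<alpha> - 1) * x powr (- \<alpha>) = 1 / x"
    using assms by (simp add: powr_minus_divide)
  then have "\<alpha> * x powr (\<alpha> - 1) * ((1 - \<alpha>) * x powr (- \<alpha>)) = \<alpha> * (1 - \<alpha>) * (1 / x)"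
    by (metis (no_types, opaque_lifting) mult.assoc mult.left_commute)
  then show ?thesis
    using True assms by (simp add: petz_zeta_def powr_difference_def divided_difference_def)
next
  case False
  then show ?thesis
    unfolding powr_difference_commute[of _ y x]
    by (simp add: petz_zeta_def powr_difference_def divided_difference_def power2_eq_square)
qed

text \<open>
  With \<open>matrix_powr (\<sigma> s) \<alpha>\<close> in place of \<open>matrix_powr (\<sigma> 0) \<alpha>\<close>, the trace vanishes for every
  \<open>s\<close>. Subtracting it leaves a product of two factors of which one is a plain difference quotient, so
  the second factor only has to be continuous.
\<close>

lemma derivative_trace_matrix_powr_double_operator_sum:
  fixes \<sigma> Y :: "real \<Rightarrow> complex^'n^'n"
  assumes \<sigma>: "continuous_on UNIV \<sigma>" "\<And>s. pos_definite (\<sigma> s)" "(\<sigma> has_vector_derivative D) (at 0)"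
    and Y: "continuous_on UNIV Y" "\<And>s. trace (Y s) = 0"
  shows "((\<lambda>s. Re (trace (matrix_powr (\<sigma> 0) \<alpha> **
      double_operator_sum (powr_difference (1 - \<alpha>)) (\<sigma> s) (\<sigma> s) (Y s)))) has_vector_derivative
    - Re (trace (double_operator_sum (powr_difference \<alpha>) (\<sigma> 0) (\<sigma> 0) D **
      double_operator_sum (powr_difference (1 - \<alpha>)) (\<sigma> 0) (\<sigma> 0) (Y 0)))) (at 0)"
proof -
  let ?T = "\<lambda>s. double_operator_sum (powr_difference (1 - \<alpha>)) (\<sigma> s) (\<sigma> s) (Y s)"
  let ?G = "\<lambda>s. Re (trace (matrix_powr (\<sigma> 0) \<alpha> ** ?T s))"
  let ?q = "\<lambda>s. (matrix_powr (\<sigma> s) \<alpha> - matrix_powr (\<sigma> 0) \<alpha>) /\<^sub>R (s - 0)"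
  have diag: "trace (matrix_powr (\<sigma> s) \<alpha> ** ?T s) = 0" for s
    by (simp add: trace_matrix_powr_double_operator_sum \<sigma>(2) Y(2))
  \<comment> \<open>By \<open>diag\<close>, \<open>?G 0\<close> is zero and so is the trace with
    \<open>matrix_powr (\<sigma> s) \<alpha>\<close>. The order of subtraction in \<open>?q\<close>
    accounts for the minus sign.\<close>
  have quot: "(?G s - ?G 0) /\<^sub>R (s - 0) = - Re (trace (?q s ** ?T s))" for s
  proof -
    have "trace (?q s ** ?T s) =
        (trace (matrix_powr (\<sigma> s) \<alpha> ** ?T s) - trace (matrix_powr (\<sigma> 0) \<alpha> ** ?T s)) /\<^sub>R s"
      by (simp add: matrix_mult.scaleR_left trace_scaleR matrix_mult.diff_left
          linear_diff[OF bounded_linear.linear[OF bounded_linear_trace]])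
    then show ?thesis by (simp add: diag)
  qed
  have "(?q \<longlongrightarrow> double_operator_sum (powr_difference \<alpha>) (\<sigma> 0) (\<sigma> 0) D) (at 0)"
    using matrix_powr_has_vector_derivative[OF \<sigma>] unfolding has_vector_derivative_iff_tendsto .
  moreover have "(?T \<longlongrightarrow> ?T 0) (at 0)"
    by (rule tendsto_double_operator_sum[OF \<sigma>(1) \<sigma>(1) Y(1) \<sigma>(2) \<sigma>(2) continuous_on_powr_difference])
  ultimately show ?thesis
    unfolding has_vector_derivative_iff_tendsto quot
    by (intro tendsto_minus tendsto_Re bounded_linear.tendsto[OF bounded_linear_trace]
        matrix_mult.tendsto)
qed

section \<open>Partial derivatives and the Hessian\<close>

lemma twice_differentiable_partial_deriv:
  fixes \<rho> :: "real^'l \<Rightarrow> 'b::real_normed_vector"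
  assumes "twice_differentiable \<rho>"
  shows line_has_vector_derivative: "((\<lambda>t. \<rho> (\<eta> + t *\<^sub>R axis k 1)) has_vector_derivative
      partial_deriv k \<rho> (\<eta> + t *\<^sub>R axis k 1)) (at t)"
    and continuous_on_partial_deriv: "continuous_on UNIV (partial_deriv k \<rho>)"
proof -
  obtain f' where f': "\<And>x. (\<rho> has_derivative blinfun_apply (f' x)) (at x)"
    and f'': "\<And>x. f' differentiable (at x)"
    using assms unfolding twice_differentiable_def by blast
  let ?e = "\<lambda>k t. t *\<^sub>R axis k 1 :: real^'l"
  have line: "((\<lambda>t. \<rho> (\<eta> + ?e k t)) has_vector_derivative f' (\<eta> + ?e k t) (axis k 1)) (at t)" for \<eta> k t
  proof -
    have "((\<lambda>t. \<eta> + ?e k t) has_vector_derivative axis k 1) (at t)"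
      by (auto intro!: derivative_eq_intros)
    then show ?thesis
      using vector_derivative_diff_chain_within[of "\<lambda>t. \<eta> + ?e k t" "axis k 1" t UNIV \<rho> "f' (\<eta> + ?e k t)"]
        has_derivative_at_withinI[OF f'] by (simp add: o_def)
  qed
  have "((\<lambda>t. \<rho> (\<eta> + ?e k t)) has_vector_derivative f' \<eta> (axis k 1)) (at 0)" for \<eta> k
    using line[of \<eta> k 0] by simp
  \<comment> \<open>Partial derivatives are the total derivative \<open>f'\<close> evaluated at axis
    vectors, so they inherit its continuity.\<close>
  then have partial: "partial_deriv k \<rho> = (\<lambda>\<eta>. f' \<eta> (axis k 1))" for k
    unfolding partial_deriv_def by (intro ext vector_derivative_at)
  show "((\<lambda>t. \<rho> (\<eta> + ?e k t)) has_vector_derivative partial_deriv k \<rho> (\<eta> + ?e k t)) (at t)"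
    unfolding partial by (rule line)
  have "continuous_on UNIV f'"
    using f'' differentiable_imp_continuous_within by (blast intro: continuous_at_imp_continuous_on)
  then show "continuous_on UNIV (partial_deriv k \<rho>)"
    unfolding partial by (intro continuous_intros)
qed

lemma partial_deriv_has_vector_derivative:
  fixes \<rho> :: "real^'l \<Rightarrow> 'b::real_normed_vector"
  assumes "twice_differentiable \<rho>"
  shows "((\<lambda>t. \<rho> (\<eta> + t *\<^sub>R axis k 1)) has_vector_derivative partial_deriv k \<rho> \<eta>) (at 0)"
  using line_has_vector_derivative[OF assms, of \<eta> k 0] by simp

lemma hermitian_partial_deriv:
  fixes \<rho> :: "real^'l \<Rightarrow> complex^'n^'n"
  assumes "twice_differentiable \<rho>" "\<And>\<eta>. hermitian (\<rho> \<eta>)"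
  shows "hermitian (partial_deriv k \<rho> \<eta>)"
  by (rule hermitian_vector_derivative[OF assms(2) partial_deriv_has_vector_derivative[OF assms(1)]])

text \<open>Along the line in direction \<open>i\<close>, the \<open>j\<close>-th partial derivative
  is \<open>?G s / ?F s\<close> up to the factor \<open>1 / (\<alpha> - 1)\<close>. Since
  \<open>?F 0 = 1\<close> and \<open>?G 0 = 0\<close>, its derivative at zero is that of
  \<open>?G\<close>, a trace of a product of two first-order operator sums.\<close>

lemma Hessian_petz_renyi_entropy:
  fixes \<rho> :: "real^'l \<Rightarrow> complex^'n^'n"
  assumes state: "\<And>\<eta>. is_state (\<rho> \<eta>)" and pd: "\<And>\<eta>. pos_definite (\<rho> \<eta>)"
    and diff: "twice_differentiable \<rho>"
  shows "partial_deriv i (partial_deriv j (\<lambda>\<epsilon>. petz_renyi_entropy \<alpha> (\<rho> \<theta>) (\<rho> (\<theta> + \<epsilon>)))) 0 =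
    1 / (\<alpha> - 1) * - Re (trace
      (double_operator_sum (powr_difference \<alpha>) (\<rho> \<theta>) (\<rho> \<theta>) (partial_deriv i \<rho> \<theta>) **
       double_operator_sum (powr_difference (1 - \<alpha>)) (\<rho> \<theta>) (\<rho> \<theta>) (partial_deriv j \<rho> \<theta>)))"
proof -
  let ?e = "\<lambda>k t. t *\<^sub>R axis k 1 :: real^'l"
  note line0 = partial_deriv_has_vector_derivative[OF diff]
  have cont: "continuous_on UNIV (\<lambda>t. \<rho> (\<eta> + ?e k t))" for \<eta> k
    using line_has_vector_derivative[OF diff] has_vector_derivative_continuous
    by (blast intro: continuous_at_imp_continuous_on)
  have contD: "continuous_on UNIV (\<lambda>s. partial_deriv j \<rho> (\<theta> + ?e i s))"
    by (rule continuous_on_compose2[OF continuous_on_partial_deriv[OF diff]])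
      (auto intro!: continuous_intros)
  have tr: "trace (partial_deriv j \<rho> \<eta>) = 0" for \<eta>
    by (rule trace_vector_derivative_zero[OF _ line0, where c = 1]) (use state in \<open>simp add: is_state_def\<close>)

  let ?A = "\<lambda>X. Re (trace (matrix_powr (\<rho> \<theta>) \<alpha> ** X))"
  let ?h = "\<lambda>\<epsilon>. petz_renyi_entropy \<alpha> (\<rho> \<theta>) (\<rho> (\<theta> + \<epsilon>))"
  let ?\<sigma> = "\<lambda>s. \<rho> (\<theta> + ?e i s)"
  let ?F = "\<lambda>s. ?A (matrix_powr (?\<sigma> s) (1 - \<alpha>))"
  let ?G = "\<lambda>s. ?A (double_operator_sum (powr_difference (1 - \<alpha>)) (?\<sigma> s) (?\<sigma> s)
    (partial_deriv j \<rho> (\<theta> + ?e i s)))"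
  let ?L = "- Re (trace
      (double_operator_sum (powr_difference \<alpha>) (\<rho> \<theta>) (\<rho> \<theta>) (partial_deriv i \<rho> \<theta>) **
       double_operator_sum (powr_difference (1 - \<alpha>)) (\<rho> \<theta>) (\<rho> \<theta>) (partial_deriv j \<rho> \<theta>)))"
  have first: "partial_deriv j ?h (?e i s) = 1 / (\<alpha> - 1) * (?G s / ?F s)" if "0 < ?F s" for s
    unfolding partial_deriv_def[of j ?h] add.assoc[symmetric]
    using petz_renyi_entropy_has_vector_derivative[OF cont pd line0, where A = "\<rho> \<theta>" and \<alpha> = \<alpha>] that
    by (intro vector_derivative_at) simp
  have G: "(?G has_real_derivative ?L) (at 0)"
    using derivative_trace_matrix_powr_double_operator_sum[OF cont pd line0 contD tr, where \<alpha> = \<alpha>]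
    by (simp add: has_real_derivative_iff_has_vector_derivative)
  \<comment> \<open>The existence of the derivative is what counts: in the quotient rule
    \<open>F'\<close> is multiplied by \<open>?G 0\<close>, which is zero.\<close>
  obtain F' where F: "(?F has_real_derivative F') (at 0)"
    using bounded_linear.has_vector_derivative[OF bounded_linear_Re_trace_mult
        matrix_powr_has_vector_derivative[OF cont pd line0]]
    unfolding has_real_derivative_iff_has_vector_derivative by blast
  have F0: "?F 0 = 1"
    using state[of \<theta>] by (simp add: matrix_powr_complement_mult pd is_state_def)
  have G0: "?G 0 = 0"
    by (simp add: trace_matrix_powr_double_operator_sum pd tr)
  have "((\<lambda>s. 1 / (\<alpha> - 1) * (?G s / ?F s)) has_real_derivative
      1 / (\<alpha> - 1) * ((?L * ?F 0 - ?G 0 * F') / (?F 0 * ?F 0))) (at 0)"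
    by (intro DERIV_cmult DERIV_divide G F) (simp add: F0 del: scaleR_zero_left)
  then have D: "((\<lambda>s. 1 / (\<alpha> - 1) * (?G s / ?F s)) has_vector_derivative 1 / (\<alpha> - 1) * ?L) (at 0)"
    unfolding F0 G0 has_real_derivative_iff_has_vector_derivative by simp
  \<comment> \<open>Continuity keeps \<open>?F\<close> positive near zero. There the formula
    \<open>first\<close> holds, and agreement near zero is enough for the outer derivative.\<close>
  have "isCont ?F 0" using F by (rule DERIV_isCont)
  then have "(?F \<longlongrightarrow> ?F 0) (nhds 0)"
    unfolding isCont_def by (rule tendsto_at_iff_tendsto_nhds[of ?F 0, THEN iffD1])
  then have "\<forall>\<^sub>F s in nhds 0. 0 < ?F s"
    by (rule order_tendstoD) (simp only: F0 zero_less_one)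
  then have "\<forall>\<^sub>F s in nhds 0. partial_deriv j ?h (0 + ?e i s) = 1 / (\<alpha> - 1) * (?G s / ?F s)"
    by eventually_elim (simp only: first add_0_left)
  then have "vector_derivative (\<lambda>s. partial_deriv j ?h (0 + ?e i s)) (at 0) =
      vector_derivative (\<lambda>s. 1 / (\<alpha> - 1) * (?G s / ?F s)) (at 0)"
    by (intro vector_derivative_cong_eq) (auto elim: eventually_mono)
  then show "partial_deriv i (partial_deriv j ?h) 0 = 1 / (\<alpha> - 1) * ?L"
    unfolding partial_deriv_def[of i "partial_deriv j ?h"] vector_derivative_at[OF D] .
qed

theorem corollary17:
  fixes \<rho> :: "real^'l \<Rightarrow> complex^'n^'n"
    and \<alpha> :: real and \<theta> :: "real^'l" and i j :: 'l
  assumes "\<And>\<eta>. is_state (\<rho> \<eta>)"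
    and "\<And>\<eta>. pos_definite (\<rho> \<eta>)"
    and "twice_differentiable \<rho>"
    and "\<alpha> \<in> {0<..<1} \<union> {1<..}"
  shows "complex_of_real (petz_renyi_information \<alpha> \<rho> \<theta> $ i $ j) =
    (\<Sum>x\<in>eigenvalues (\<rho> \<theta>). \<Sum>y\<in>eigenvalues (\<rho> \<theta>).
       complex_of_real (petz_zeta \<alpha> x y) *
       trace (eigenprojection (\<rho> \<theta>) x ** partial_deriv i \<rho> \<theta> **
              eigenprojection (\<rho> \<theta>) y ** partial_deriv j \<rho> \<theta>))"
proof -
  let ?A = "\<rho> \<theta>"
  let ?T = "\<lambda>a k. double_operator_sum (powr_difference a) ?A ?A (partial_deriv k \<rho> \<theta>)"
  let ?c = "1 / (\<alpha> * (1 - \<alpha>))"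
  have \<alpha>: "\<alpha> \<noteq> 0" "\<alpha> \<noteq> 1" using assms(4) by auto
  have herm: "hermitian (?T a k)" for a k
    by (intro hermitian_double_operator_sum hermitian_partial_deriv assms(3)
        pos_definite_hermitian assms(2) powr_difference_commute)
  \<comment> \<open>The minus sign of the mixed derivative turns \<alpha> - 1 into 1 - \<alpha>,
    which yields the prefactor of \<zeta>.\<close>
  have "1 / \<alpha> * (1 / (\<alpha> - 1) * - r) = ?c * r" for r
    using \<alpha> by (simp add: divide_simps) (simp add: algebra_simps)
  then have "petz_renyi_information \<alpha> \<rho> \<theta> $ i $ j = ?c * Re (trace (?T \<alpha> i ** ?T (1 - \<alpha>) j))"
    by (simp only: petz_renyi_information_def vec_lambda_beta Hessian_petz_renyi_entropy[OF assms(1-3)])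
  then have "complex_of_real (petz_renyi_information \<alpha> \<rho> \<theta> $ i $ j) =
      complex_of_real ?c * trace (?T \<alpha> i ** ?T (1 - \<alpha>) j)"
    by (simp only: of_real_mult trace_mult_hermitian_real herm)
  also have "\<dots> = (\<Sum>x\<in>eigenvalues ?A. \<Sum>y\<in>eigenvalues ?A.
      complex_of_real (?c * (powr_difference \<alpha> x y * powr_difference (1 - \<alpha>) y x)) *
      trace (eigenprojection ?A x ** partial_deriv i \<rho> \<theta> ** eigenprojection ?A y ** partial_deriv j \<rho> \<theta>))"
    by (simp only: trace_double_operator_sum_mult[OF pos_definite_hermitian[OF assms(2)]]
        sum_distrib_left of_real_mult mult.assoc)
  also have "\<dots> = (\<Sum>x\<in>eigenvalues ?A. \<Sum>y\<in>eigenvalues ?A. complex_of_real (petz_zeta \<alpha> x y) *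
      trace (eigenprojection ?A x ** partial_deriv i \<rho> \<theta> ** eigenprojection ?A y ** partial_deriv j \<rho> \<theta>))"
    by (intro sum.cong refl) (simp only: petz_zeta_eq[OF eigenvalues_pos_definite[OF assms(2)]
          eigenvalues_pos_definite[OF assms(2)] \<alpha>])
  finally show ?thesis .
qed

end
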